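(* Let $0<\alpha<1$, $\mu>0$, $0<x_1<x_2<\dots<x_m<l$, and consider the problem $$\partial_{0t}^{\alpha}u=u_{xx}+\mu\,\frac{\partial}{\partial t}u_{xx}+\sum_{k=1}^m q_k(x,t)\,u(x_k,t)+f(x,t),\qquad 0<x<l,\ 0<t\le T,$$ $$u(0,t)=0,\quad u(l,t)=0\ \ (0\le t\le T),\qquad u(x,0)=u_0(x)\ \ (0\le x\le l).$$ If $|q_k(x,t)|<c_1$ for $k=1,2,\dots,m$, then for the solution $u$ of this problem it holds that $$D_{0t}^{\alpha-1}\|u\|_0^2+\|u_x\|_0^2\le M(T)\left(\int_0^t\|f\|_0^2\,d\tau+\|u_0'\|_0^2+\|u_0\|_0^2\right),$$ where $M(T)>0$ is a constant depending only on the input data of the problem.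
   Context: The Caputo fractional derivative of order $\alpha\in(0,1)$ is $$\partial_{0t}^{\alpha}u(x,t)=\frac1{\Gamma(1-\alpha)}\int_0^t\frac{\partial u(x,\eta)}{\partial\eta}(t-\eta)^{-\alpha}\,d\eta.$$ The norm is $\|v\|_0^2=\int_0^l v(x)^2\,dx$, taken in the variable $x$; $\|u\|_0$ and $\|u_x\|_0$ on the left are functions of $t$, and in the integral on the right $f$ is taken at time $\tau$. The operator $$D_{0t}^{\alpha-1}g=\frac1{\Gamma(1-\alpha)}\int_0^t(t-\eta)^{-\alpha}g(\eta)\,d\eta$$ is the Riemann–Liouville fractional integral of order $1-\alpha$, applied here to $g(\eta)=\|u(\cdot,\eta)\|_0^2$. *)

theory Defs
  imports "HOL-Analysis.Analysis"
begin

text \<open>Functions of \<open>(x, t)\<close> are curried, \<open>u x t\<close>.  Partial derivatives on the closed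
  rectangle \<open>[0, l] \<times> [0, T]\<close> are taken within the rectangle, so they are one-sided on its
  boundary and do not depend on values of the function outside.\<close>

definition partial_x :: "real \<Rightarrow> (real \<Rightarrow> real \<Rightarrow> real) \<Rightarrow> real \<Rightarrow> real \<Rightarrow> real" where
  "partial_x l u x t = vector_derivative (\<lambda>y. u y t) (at x within {0..l})"

definition partial_t :: "real \<Rightarrow> (real \<Rightarrow> real \<Rightarrow> real) \<Rightarrow> real \<Rightarrow> real \<Rightarrow> real" where
  "partial_t T u x t = vector_derivative (\<lambda>s. u x s) (at t within {0..T})"

definition caputo_deriv :: "real \<Rightarrow> (real \<Rightarrow> real) \<Rightarrow> real \<Rightarrow> real" where
  "caputo_deriv \<alpha> g t =
     1 / Gamma (1 - \<alpha>) * integral {0..t} (\<lambda>\<eta>. deriv g \<eta> * (t - \<eta>) powr (- \<alpha>))"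

text \<open>The fractional integral of order \<open>1 - \<alpha>\<close>, written \<open>D\<close> with exponent \<open>\<alpha> - 1\<close>.\<close>

definition RL_integral :: "real \<Rightarrow> (real \<Rightarrow> real) \<Rightarrow> real \<Rightarrow> real" where
  "RL_integral \<alpha> g t =
     1 / Gamma (1 - \<alpha>) * integral {0..t} (\<lambda>\<eta>. (t - \<eta>) powr (- \<alpha>) * g \<eta>)"

definition norm0_sq :: "real \<Rightarrow> (real \<Rightarrow> real) \<Rightarrow> real" where
  "norm0_sq l v = integral {0..l} (\<lambda>x. (v x)\<^sup>2)"

text \<open>Regularity of a classical solution: smooth up to the lateral boundary, while the time
  derivatives may be singular at \<open>t = 0\<close>, as is usual for fractional equations.
  Integrability of \<open>u\<^sub>t(x, \<cdot>)\<close> is what makes the Caputo derivative meaningful.\<close>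

definition regular_on_rectangle :: "real \<Rightarrow> real \<Rightarrow> (real \<Rightarrow> real \<Rightarrow> real) \<Rightarrow> bool" where
  "regular_on_rectangle l T u \<longleftrightarrow>
     continuous_on ({0..l} \<times> {0..T}) (\<lambda>(x, t). u x t) \<and>
     (\<forall>x\<in>{0..l}. \<forall>t\<in>{0..T}. (\<lambda>y. u y t) differentiable (at x within {0..l})) \<and>
     continuous_on ({0..l} \<times> {0..T}) (\<lambda>(x, t). partial_x l u x t) \<and>
     (\<forall>x\<in>{0..l}. \<forall>t\<in>{0<..T}.
        (\<lambda>y. partial_x l u y t) differentiable (at x within {0..l}) \<and>
        (\<lambda>s. u x s) differentiable (at t within {0..T}) \<and>
        (\<lambda>s. partial_x l (partial_x l u) x s) differentiable (at t within {0..T})) \<and>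
     continuous_on ({0..l} \<times> {0<..T}) (\<lambda>(x, t). partial_x l (partial_x l u) x t) \<and>
     continuous_on ({0..l} \<times> {0<..T}) (\<lambda>(x, t). partial_t T u x t) \<and>
     continuous_on ({0..l} \<times> {0<..T})
       (\<lambda>(x, t). partial_t T (partial_x l (partial_x l u)) x t) \<and>
     (\<forall>x\<in>{0<..<l}. (\<lambda>t. partial_t T u x t) absolutely_integrable_on {0<..T})"

definition is_solution ::
  "real \<Rightarrow> real \<Rightarrow> real \<Rightarrow> real \<Rightarrow> nat \<Rightarrow> (nat \<Rightarrow> real) \<Rightarrow> (nat \<Rightarrow> real \<Rightarrow> real \<Rightarrow> real) \<Rightarrow>
   (real \<Rightarrow> real \<Rightarrow> real) \<Rightarrow> (real \<Rightarrow> real) \<Rightarrow> (real \<Rightarrow> real \<Rightarrow> real) \<Rightarrow> bool" where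
  "is_solution \<alpha> \<mu> l T m xs q f u0 u \<longleftrightarrow>
     regular_on_rectangle l T u \<and>
     (\<forall>x\<in>{0<..<l}. \<forall>t\<in>{0<..T}.
        caputo_deriv \<alpha> (\<lambda>s. u x s) t =
          partial_x l (partial_x l u) x t
          + \<mu> * partial_t T (partial_x l (partial_x l u)) x t
          + (\<Sum>k=1..m. q k x t * u (xs k) t) + f x t) \<and>
     (\<forall>t\<in>{0..T}. u 0 t = 0 \<and> u l t = 0) \<and>
     (\<forall>x\<in>{0..l}. u x 0 = u0 x)"

text \<open>Square integrability over the space-time rectangle, which makes the integral of
  \<open>norm0_sq l (f(\<cdot>, \<tau>))\<close> in \<open>\<tau>\<close> a genuine (finite) one.\<close>

definition square_integrable_on_rectangle ::
  "real \<Rightarrow> real \<Rightarrow> (real \<Rightarrow> real \<Rightarrow> real) \<Rightarrow> bool" where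
  "square_integrable_on_rectangle l T f \<longleftrightarrow>
     set_borel_measurable lborel ({0<..<l} \<times> {0<..<T}) (\<lambda>(x, t). f x t) \<and>
     set_integrable lborel ({0<..<l} \<times> {0<..<T}) (\<lambda>(x, t). (f x t)\<^sup>2)"

end

theory Submission
  imports Defs
begin

text \<open>
  Multiply the equation by \<open>u\<close> and integrate over \<open>[0, l]\<close>. Alikhanov's inequality
  \<open>u \<partial>\<^sup>\<alpha>u \<ge> \<partial>\<^sup>\<alpha>(u\<^sup>2)/2\<close> bounds the fractional term from below, the second derivatives give
  \<open>\<parallel>u\<^sub>x\<parallel>\<^sup>2 + (\<mu>/2) d/dt \<parallel>u\<^sub>x\<parallel>\<^sup>2\<close>, and \<open>u(x)\<^sup>2 \<le> l \<parallel>u\<^sub>x\<parallel>\<^sup>2\<close> absorbs the loaded terms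
  \<open>q\<^sub>k u(x\<^sub>k, t)\<close>. Integration in time turns the Caputo derivative of \<open>\<parallel>u\<parallel>\<^sup>2\<close> into the
  Riemann--Liouville integral, and Gronwall's inequality concludes.

  Since \<open>u\<^sub>t\<close> may be singular at \<open>t = 0\<close>, without uniformity in \<open>x\<close>, the kernel \<open>r\<^sup>-\<^sup>\<alpha>\<close> is
  replaced by \<open>(r\<^sup>2 + \<epsilon>\<^sup>2)\<^sup>-\<^sup>\<alpha>\<^sup>/\<^sup>2\<close>, continued by a constant to \<open>r < 0\<close>. With this
  \<open>C\<^sup>1\<close> kernel the fractional derivative involves no derivative of \<open>u\<close>, and it converges to the
  Caputo derivative uniformly on \<open>[0, l] \<times> [2a, T]\<close> for every \<open>a > 0\<close>. The energy inequality is
  integrated over \<open>[2a, t]\<close>; then \<open>\<epsilon> \<rightarrow> 0\<close> and \<open>a \<rightarrow> 0\<close>.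
\<close>

section \<open>Differentiable memory kernels\<close>

lemma continuous_on_curried:
  fixes u :: "'a::topological_space \<Rightarrow> 'b::topological_space \<Rightarrow> 'c::topological_space"
  assumes "continuous_on (A \<times> B) (\<lambda>(x, t). u x t)"
    and "continuous_on S g" "continuous_on S h" "\<And>z. z \<in> S \<Longrightarrow> g z \<in> A \<and> h z \<in> B"
  shows "continuous_on S (\<lambda>z. u (g z) (h z))"
  using continuous_on_compose2[OF assms(1) continuous_on_Pair[OF assms(2,3)]] assms(4)
  by auto

text \<open>Positive nonincreasing memory kernels of class C^1 are all that the fractional product
  inequality needs. Being constant on the past lets every convolution over [0, \<tau>] be written
  over the fixed interval [0, T], so that it can be differentiated under the integral sign.\<close>

locale memory_kernel =
  fixes k k' :: "real \<Rightarrow> real"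
  assumes deriv_k: "\<And>r. (k has_real_derivative k' r) (at r)"
    and cont_k': "continuous_on UNIV k'"
    and k_past: "\<And>r. r \<le> 0 \<Longrightarrow> k r = k 0"
    and k'_past: "\<And>r. r \<le> 0 \<Longrightarrow> k' r = 0"
    and k'_nonpos: "\<And>r. k' r \<le> 0"
    and k_nonneg: "\<And>r. 0 \<le> k r"
begin

lemma cont_k: "continuous_on UNIV k"
  by (metis DERIV_continuous_on deriv_k has_field_derivative_at_within)

lemma cont_k_comp [continuous_intros]:
  "continuous_on S g \<Longrightarrow> continuous_on S (\<lambda>x. k (g x))"
  using continuous_on_compose2[OF cont_k] by blast

lemma cont_k'_comp [continuous_intros]:
  "continuous_on S g \<Longrightarrow> continuous_on S (\<lambda>x. k' (g x))"
  using continuous_on_compose2[OF cont_k'] by blast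

text \<open>Integration by parts turns \<open>\<integral>\<^sub>0\<^sup>\<tau> w'(\<eta>) k(\<tau> - \<eta>) d\<eta>\<close> into this expression, which
  involves no derivative of \<open>w\<close>. The integral runs over all of \<open>[0, T]\<close> because \<open>k'\<close>
  vanishes on negative arguments.\<close>

definition regularized_deriv :: "real \<Rightarrow> (real \<Rightarrow> real) \<Rightarrow> real \<Rightarrow> real" where
  "regularized_deriv T w \<tau> =
     k 0 * w \<tau> + integral {0..T} (\<lambda>\<eta>. k' (\<tau> - \<eta>) * w \<eta>) - k \<tau> * w 0"

text \<open>The total mass of \<open>k'\<close> over the fixed interval; it supplies the coefficient
  of \<open>(w \<tau>)\<^sup>2\<close> when the square in the product inequality is
  expanded.\<close>

lemma kernel_increment:
  assumes "\<tau> \<le> T" "0 \<le> T"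
  shows "((\<lambda>\<eta>. k' (\<tau> - \<eta>)) has_integral (k \<tau> - k 0)) {0..T}"
proof -
  have "((\<lambda>\<eta>. k' (\<tau> - \<eta>)) has_integral ((- k (\<tau> - T)) - (- k (\<tau> - 0)))) {0..T}"
  proof (rule fundamental_theorem_of_calculus[OF assms(2)])
    fix x
    have "((\<lambda>x. - k (\<tau> - x)) has_real_derivative k' (\<tau> - x)) (at x)"
      by (auto intro!: derivative_eq_intros DERIV_chain2[OF deriv_k])
    then show "((\<lambda>x. - k (\<tau> - x)) has_vector_derivative k' (\<tau> - x)) (at x within {0..T})"
      by (simp add: has_real_derivative_iff_has_vector_derivative has_vector_derivative_at_within)
  qed
  moreover have "k (\<tau> - T) = k 0"
    using assms by (intro k_past) auto
  ultimately show ?thesis by simp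
qed

lemma integral_kernel_truncate:
  assumes w: "continuous_on {0..T} w" and t: "\<tau> \<in> {0..T}"
  shows "integral {0..T} (\<lambda>\<eta>. k' (\<tau> - \<eta>) * w \<eta>) = integral {0..\<tau>} (\<lambda>\<eta>. k' (\<tau> - \<eta>) * w \<eta>)"
proof -
  have "integral {0..T} (\<lambda>\<eta>. k' (\<tau> - \<eta>) * w \<eta>) =
      integral {0..\<tau>} (\<lambda>\<eta>. k' (\<tau> - \<eta>) * w \<eta>) + integral {\<tau>..T} (\<lambda>\<eta>. k' (\<tau> - \<eta>) * w \<eta>)"
    by (rule Henstock_Kurzweil_Integration.integral_combine[symmetric])
      (use t in \<open>auto intro!: integrable_continuous_real continuous_intros w\<close>)
  also have "integral {\<tau>..T} (\<lambda>\<eta>. k' (\<tau> - \<eta>) * w \<eta>) = integral {\<tau>..T} (\<lambda>\<eta>. 0)"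
    by (rule integral_cong) (simp add: k'_past)
  finally show ?thesis by simp
qed

text \<open>Alikhanov's inequality for a smooth kernel. Twice the difference of the two sides equals
  the integral of \<open>- k' (\<tau> - \<eta>) * (w \<tau> - w \<eta>)\<^sup>2\<close> plus
  \<open>k \<tau> * (w \<tau> - w 0)\<^sup>2\<close>, and both are nonnegative by the sign
  conditions on \<open>k\<close> and \<open>k'\<close>.\<close>

lemma regularized_deriv_product_ge:
  assumes w: "continuous_on {0..T} w" and t: "\<tau> \<in> {0..T}"
  shows "w \<tau> * regularized_deriv T w \<tau> \<ge> regularized_deriv T (\<lambda>s. (w s)\<^sup>2) \<tau> / 2"
proof -
  have T: "0 \<le> T" "\<tau> \<le> T" using t by auto
  have K: "((\<lambda>\<eta>. k' (\<tau> - \<eta>)) has_integral (k \<tau> - k 0)) {0..T}"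
    by (rule kernel_increment) (use t in auto)
  define I1 where "I1 = integral {0..T} (\<lambda>\<eta>. k' (\<tau> - \<eta>) * w \<eta>)"
  define I2 where "I2 = integral {0..T} (\<lambda>\<eta>. k' (\<tau> - \<eta>) * (w \<eta>)\<^sup>2)"
  have i1: "((\<lambda>\<eta>. k' (\<tau> - \<eta>) * w \<eta>) has_integral I1) {0..T}"
    unfolding I1_def
    by (intro integrable_integral integrable_continuous_real continuous_intros w)
  have i2: "((\<lambda>\<eta>. k' (\<tau> - \<eta>) * (w \<eta>)\<^sup>2) has_integral I2) {0..T}"
    unfolding I2_def
    by (intro integrable_integral integrable_continuous_real continuous_intros w)
  have "((\<lambda>\<eta>. (w \<tau>)\<^sup>2 * k' (\<tau> - \<eta>) - 2 * w \<tau> * (k' (\<tau> - \<eta>) * w \<eta>) + k' (\<tau> - \<eta>) * (w \<eta>)\<^sup>2)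
      has_integral (w \<tau>)\<^sup>2 * (k \<tau> - k 0) - 2 * w \<tau> * I1 + I2) {0..T}"
    by (intro has_integral_add has_integral_diff has_integral_mult_right K i1 i2)
  moreover have "(w \<tau>)\<^sup>2 * k' (\<tau> - \<eta>) - 2 * w \<tau> * (k' (\<tau> - \<eta>) * w \<eta>) + k' (\<tau> - \<eta>) * (w \<eta>)\<^sup>2 \<le> 0" for \<eta>
  proof -
    have "(w \<tau>)\<^sup>2 * k' (\<tau> - \<eta>) - 2 * w \<tau> * (k' (\<tau> - \<eta>) * w \<eta>) + k' (\<tau> - \<eta>) * (w \<eta>)\<^sup>2 =
        k' (\<tau> - \<eta>) * (w \<tau> - w \<eta>)\<^sup>2"
      by (simp add: power2_eq_square algebra_simps)
    then show ?thesis by (simp add: mult_nonpos_nonneg k'_nonpos)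
  qed
  ultimately have le: "(w \<tau>)\<^sup>2 * (k \<tau> - k 0) - 2 * w \<tau> * I1 + I2 \<le> 0"
    by (rule has_integral_le[OF _ has_integral_0])
  have "0 \<le> k \<tau> * (w \<tau> - w 0)\<^sup>2" by (simp add: k_nonneg)
  then show ?thesis
    using le unfolding regularized_deriv_def I1_def[symmetric] I2_def[symmetric]
    by (simp add: power2_eq_square field_simps)
qed

lemma continuous_on_regularized_deriv_param:
  assumes u: "continuous_on ({0..l} \<times> {0..T}) (\<lambda>(x, t). u x t)" and t: "\<tau> \<in> {0..T}"
  shows "continuous_on {0..l} (\<lambda>x. regularized_deriv T (u x) \<tau>)"
proof -
  note u2 = continuous_on_curried[OF u]
  have "continuous_on {0..l} (\<lambda>x. integral (cbox 0 T) (\<lambda>\<eta>. k' (\<tau> - \<eta>) * u x \<eta>))"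
    by (rule integral_continuous_on_param)
      (unfold case_prod_beta, intro continuous_intros u2, auto)
  then show ?thesis
    unfolding regularized_deriv_def using t
    by (intro continuous_intros u2) auto
qed

text \<open>The product inequality holds for each x; integrating it over [0, l] commutes with the
  regularized derivative, which is linear and acts in time only.\<close>

lemma integral_regularized_deriv_product_ge:
  assumes u: "continuous_on ({0..l} \<times> {0..T}) (\<lambda>(x, t). u x t)" and t: "\<tau> \<in> {0..T}"
  shows "integral {0..l} (\<lambda>x. u x \<tau> * regularized_deriv T (u x) \<tau>)
    \<ge> regularized_deriv T (\<lambda>s. norm0_sq l (\<lambda>x. u x s)) \<tau> / 2"
proof -
  note u2 = continuous_on_curried[OF u]
  define Q where "Q x = integral {0..T} (\<lambda>\<eta>. k' (\<tau> - \<eta>) * (u x \<eta>)\<^sup>2)" for x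
  have "continuous_on {0..l} (\<lambda>x. integral (cbox 0 T) (\<lambda>\<eta>. k' (\<tau> - \<eta>) * (u x \<eta>)\<^sup>2))"
    by (rule integral_continuous_on_param)
      (unfold case_prod_beta, intro continuous_intros u2, auto)
  then have contQ: "continuous_on {0..l} Q" unfolding Q_def[abs_def] by simp
  \<comment> \<open>Fubini for a continuous integrand: the memory term of u^2, integrated in x, is
    the memory term of the squared norm.\<close>
  have "integral {0..l} Q = integral {0..T} (\<lambda>\<eta>. integral {0..l} (\<lambda>x. k' (\<tau> - \<eta>) * (u x \<eta>)\<^sup>2))"
    unfolding Q_def cbox_interval[symmetric]
    by (rule integral_swap_continuous, unfold case_prod_beta cbox_Pair_eq, intro continuous_intros u2) auto
  also have "\<dots> = integral {0..T} (\<lambda>\<eta>. k' (\<tau> - \<eta>) * norm0_sq l (\<lambda>x. u x \<eta>))"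
    by (simp add: norm0_sq_def)
  finally have iQ: "(Q has_integral integral {0..T} (\<lambda>\<eta>. k' (\<tau> - \<eta>) * norm0_sq l (\<lambda>x. u x \<eta>))) {0..l}"
    using integrable_integral[OF integrable_continuous_real[OF contQ]] by simp
  have ig: "((\<lambda>x. (u x s)\<^sup>2) has_integral norm0_sq l (\<lambda>x. u x s)) {0..l}" if "s \<in> {0..T}" for s
    unfolding norm0_sq_def using that
    by (intro integrable_integral integrable_continuous_real continuous_intros u2) auto
  have "((\<lambda>x. (k 0 * (u x \<tau>)\<^sup>2 + Q x - k \<tau> * (u x 0)\<^sup>2) / 2) has_integral
      regularized_deriv T (\<lambda>s. norm0_sq l (\<lambda>x. u x s)) \<tau> / 2) {0..l}"
    unfolding regularized_deriv_def using t
    by (intro has_integral_divide has_integral_add has_integral_diff has_integral_mult_right iQ ig) auto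
  moreover have "((\<lambda>x. u x \<tau> * regularized_deriv T (u x) \<tau>) has_integral
      integral {0..l} (\<lambda>x. u x \<tau> * regularized_deriv T (u x) \<tau>)) {0..l}"
    using t by (intro integrable_integral integrable_continuous_real continuous_intros u2
        continuous_on_regularized_deriv_param[OF u]) auto
  moreover have "(k 0 * (u x \<tau>)\<^sup>2 + Q x - k \<tau> * (u x 0)\<^sup>2) / 2 \<le> u x \<tau> * regularized_deriv T (u x) \<tau>"
    if "x \<in> {0..l}" for x
  proof -
    have "continuous_on {0..T} (u x)"
      using that by (intro u2 continuous_intros) auto
    from regularized_deriv_product_ge[OF this t] show ?thesis
      by (simp add: regularized_deriv_def Q_def)
  qed
  ultimately show ?thesis by (rule has_integral_le)
qed

definition memory :: "(real \<Rightarrow> real) \<Rightarrow> real \<Rightarrow> real" where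
  "memory G t = integral {0..t} (\<lambda>\<eta>. k (t - \<eta>) * G \<eta>)"

text \<open>The derivative of a convolution k * G is k * G' plus \<open>k t * G 0\<close>; here
  \<open>regularized_deriv\<close> stands for k * G', so G need only be continuous.\<close>

lemma memory_has_derivative:
  assumes G: "continuous_on {0..T} G" and t: "t \<in> {0..T}"
  shows "(memory G has_vector_derivative (regularized_deriv T G t + k t * G 0)) (at t within {0..T})"
proof -
  \<comment> \<open>Subtracting \<open>k 0\<close> makes the integrand vanish for \<eta> \<ge> s, so
    the moving upper limit can be replaced by T and the Leibniz rule for a fixed domain
    applies.\<close>
  have eq: "memory G s = k 0 * integral {0..s} G + integral (cbox 0 T) (\<lambda>\<eta>. (k (s - \<eta>) - k 0) * G \<eta>)"
    if s: "s \<in> {0..T}" for s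
  proof -
    have G': "continuous_on {0..s} G"
      using G by (rule continuous_on_subset) (use s in auto)
    have "integral {0..T} (\<lambda>\<eta>. (k (s - \<eta>) - k 0) * G \<eta>) =
      integral {0..s} (\<lambda>\<eta>. (k (s - \<eta>) - k 0) * G \<eta>) + integral {s..T} (\<lambda>\<eta>. (k (s - \<eta>) - k 0) * G \<eta>)"
      using s by (intro Henstock_Kurzweil_Integration.integral_combine[symmetric]
          integrable_continuous_real continuous_intros G) auto
    also have "integral {s..T} (\<lambda>\<eta>. (k (s - \<eta>) - k 0) * G \<eta>) = integral {s..T} (\<lambda>\<eta>. 0)"
      by (rule integral_cong) (simp add: k_past[of "s - _"])
    also have "integral {0..s} (\<lambda>\<eta>. (k (s - \<eta>) - k 0) * G \<eta>) =
      integral {0..s} (\<lambda>\<eta>. k (s - \<eta>) * G \<eta>) - integral {0..s} (\<lambda>\<eta>. k 0 * G \<eta>)"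
      unfolding left_diff_distrib
      by (rule Henstock_Kurzweil_Integration.integral_diff)
         (intro integrable_continuous_real continuous_intros G')+
    finally show ?thesis by (simp add: memory_def)
  qed
  have "((\<lambda>s. integral (cbox 0 T) (\<lambda>\<eta>. (k (s - \<eta>) - k 0) * G \<eta>)) has_vector_derivative
      integral (cbox 0 T) (\<lambda>\<eta>. k' (t - \<eta>) * G \<eta>)) (at t within {0..T})"
  proof (rule leibniz_rule_vector_derivative)
    fix s \<eta>
    have "((\<lambda>s. (k (s - \<eta>) - k 0) * G \<eta>) has_real_derivative k' (s - \<eta>) * G \<eta>) (at s)"
      by (auto intro!: derivative_eq_intros DERIV_chain2[OF deriv_k])
    then show "((\<lambda>s. (k (s - \<eta>) - k 0) * G \<eta>) has_vector_derivative k' (s - \<eta>) * G \<eta>)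
        (at s within {0..T})"
      by (simp add: has_real_derivative_iff_has_vector_derivative has_vector_derivative_at_within)
  next
    show "continuous_on ({0..T} \<times> cbox 0 T) (\<lambda>(s, \<eta>). k' (s - \<eta>) * G \<eta>)"
      unfolding case_prod_beta
      by (intro continuous_intros continuous_on_compose2[OF G]) auto
  next
    fix s
    show "(\<lambda>\<eta>. (k (s - \<eta>) - k 0) * G \<eta>) integrable_on cbox 0 T"
      unfolding cbox_interval by (intro integrable_continuous_real continuous_intros G)
  qed (use t in auto)
  moreover have "((\<lambda>s. k 0 * integral {0..s} G) has_vector_derivative k 0 * G t) (at t within {0..T})"
    by (intro has_vector_derivative_mult_right integral_has_vector_derivative G t)
  ultimately have "((\<lambda>s. k 0 * integral {0..s} G + integral (cbox 0 T) (\<lambda>\<eta>. (k (s - \<eta>) - k 0) * G \<eta>))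
      has_vector_derivative (k 0 * G t + integral (cbox 0 T) (\<lambda>\<eta>. k' (t - \<eta>) * G \<eta>))) (at t within {0..T})"
    by (rule has_vector_derivative_add[rotated])
  then have "(memory G has_vector_derivative (k 0 * G t + integral (cbox 0 T) (\<lambda>\<eta>. k' (t - \<eta>) * G \<eta>)))
      (at t within {0..T})"
    by (rule has_vector_derivative_transform[OF t eq, rotated])
  then show ?thesis by (simp add: regularized_deriv_def)
qed

end

section \<open>Regularization of the power kernel\<close>

text \<open>Squaring removes the kink of the positive part; this is why \<open>reg_kernel\<close>
  can be frozen on r \<le> 0 and still be C^1.\<close>

lemma has_real_derivative_pos_part_squared:
  "((\<lambda>r. (max 0 r)\<^sup>2) has_real_derivative 2 * max 0 r) (at (r::real))"
proof -
  consider "r > 0" | "r < 0" | "r = 0" by linarith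
  then show ?thesis
  proof cases
    case 1
    have "((\<lambda>r. r\<^sup>2) has_real_derivative 2 * r) (at r)"
      by (auto intro!: derivative_eq_intros)
    moreover have "eventually (\<lambda>s. s\<^sup>2 = (max 0 s)\<^sup>2) (nhds r)"
      using eventually_nhds_in_open[of "{0<..}" r] 1 by (auto elim: eventually_mono)
    ultimately show ?thesis
      using 1 by (subst (asm) DERIV_cong_ev[OF refl _ refl]) auto
  next
    case 2
    have "((\<lambda>r::real. 0::real) has_real_derivative 0) (at r)" by simp
    moreover have "eventually (\<lambda>s. 0 = (max 0 s)\<^sup>2) (nhds r)"
      using eventually_nhds_in_open[of "{..<0}" r] 2 by (auto elim!: eventually_mono)
    ultimately show ?thesis
      using 2 by (subst (asm) DERIV_cong_ev[OF refl _ refl]) auto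
  next
    case 3
    \<comment> \<open>At the origin the difference quotient is at most |h| in absolute
      value.\<close>
    have "((\<lambda>h::real. (max 0 h)\<^sup>2 / h) \<longlongrightarrow> 0) (at 0)"
      by (rule Lim_null_comparison[of _ abs])
        (auto simp: max_def power2_eq_square intro!: always_eventually tendsto_eq_intros)
    then show ?thesis using 3 by (simp add: DERIV_def)
  qed
qed

definition reg_kernel :: "real \<Rightarrow> real \<Rightarrow> real \<Rightarrow> real" where
  "reg_kernel \<alpha> \<epsilon> r = ((max 0 r)\<^sup>2 + \<epsilon>\<^sup>2) powr (- \<alpha> / 2)"

definition reg_kernel' :: "real \<Rightarrow> real \<Rightarrow> real \<Rightarrow> real" where
  "reg_kernel' \<alpha> \<epsilon> r = - \<alpha> * max 0 r * ((max 0 r)\<^sup>2 + \<epsilon>\<^sup>2) powr (- \<alpha> / 2 - 1)"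

lemma memory_kernel_reg:
  assumes "0 < \<alpha>" "0 < \<epsilon>"
  shows "memory_kernel (reg_kernel \<alpha> \<epsilon>) (reg_kernel' \<alpha> \<epsilon>)"
proof
  have pos: "0 < (max 0 r)\<^sup>2 + \<epsilon>\<^sup>2" for r :: real
    using assms by (intro add_nonneg_pos) auto
  fix r :: real
  show "(reg_kernel \<alpha> \<epsilon> has_real_derivative reg_kernel' \<alpha> \<epsilon> r) (at r)"
    unfolding reg_kernel_def[abs_def] reg_kernel'_def
    by (rule derivative_eq_intros has_real_derivative_pos_part_squared pos refl)+ simp
  show "continuous_on UNIV (reg_kernel' \<alpha> \<epsilon>)"
    unfolding reg_kernel'_def[abs_def]
    using pos by (intro continuous_intros) (auto simp: less_imp_neq[THEN not_sym])
  show "reg_kernel' \<alpha> \<epsilon> r \<le> 0"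
    using assms by (auto simp: reg_kernel'_def intro!: mult_nonneg_nonneg)
qed (auto simp: reg_kernel_def reg_kernel'_def)

lemma reg_kernel_le:
  assumes "0 < \<alpha>" "0 < r"
  shows "reg_kernel \<alpha> \<epsilon> r \<le> r powr (- \<alpha>)"
proof -
  have "reg_kernel \<alpha> \<epsilon> r \<le> (r\<^sup>2) powr (- \<alpha> / 2)"
    using assms unfolding reg_kernel_def by (intro powr_mono2') auto
  also have "\<dots> = r powr (- \<alpha>)"
    using assms by (simp add: powr_powr flip: powr_numeral)
  finally show ?thesis .
qed

text \<open>From r^2 + \<epsilon>^2 \<le> (r + \<epsilon>)^2. The shifted power has an explicit
  antiderivative, which makes the distance of the regularized kernel from r^(-\<alpha>)
  computable.\<close>

lemma reg_kernel_ge: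
  assumes "0 < \<alpha>" "0 \<le> r" "0 < \<epsilon>"
  shows "(r + \<epsilon>) powr (- \<alpha>) \<le> reg_kernel \<alpha> \<epsilon> r"
proof -
  have "(r + \<epsilon>) powr (- \<alpha>) = ((r + \<epsilon>)\<^sup>2) powr (- \<alpha> / 2)"
    using assms by (simp add: powr_powr flip: powr_numeral)
  also have "\<dots> \<le> reg_kernel \<alpha> \<epsilon> r"
    using assms unfolding reg_kernel_def
    by (intro powr_mono2') (auto simp: power2_sum intro!: add_nonneg_pos)
  finally show ?thesis .
qed

lemma tendsto_reg_kernel:
  assumes "0 < r"
  shows "((\<lambda>\<epsilon>. reg_kernel \<alpha> \<epsilon> r) \<longlongrightarrow> r powr (- \<alpha>)) (at_right 0)"
proof -
  have "((\<lambda>\<epsilon>. (r\<^sup>2 + \<epsilon>\<^sup>2) powr (- \<alpha> / 2)) \<longlongrightarrow> (r\<^sup>2 + 0\<^sup>2) powr (- \<alpha> / 2)) (at_right 0)"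
    using assms by (intro tendsto_intros) auto
  then show ?thesis
    using assms by (simp add: reg_kernel_def powr_powr flip: powr_numeral)
qed

section \<open>The difference between the power kernel and its regularization\<close>

definition kernel_defect :: "real \<Rightarrow> real \<Rightarrow> real \<Rightarrow> real" where
  "kernel_defect \<alpha> \<epsilon> r = r powr (- \<alpha>) - reg_kernel \<alpha> \<epsilon> r"

definition kernel_defect' :: "real \<Rightarrow> real \<Rightarrow> real \<Rightarrow> real" where
  "kernel_defect' \<alpha> \<epsilon> r = - \<alpha> * r powr (- \<alpha> - 1) - reg_kernel' \<alpha> \<epsilon> r"

lemma kernel_defect_nonneg: "0 < \<alpha> \<Longrightarrow> 0 < r \<Longrightarrow> 0 \<le> kernel_defect \<alpha> \<epsilon> r"
  using reg_kernel_le by (simp add: kernel_defect_def)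

lemma kernel_defect_deriv:
  assumes "0 < \<alpha>" "0 < \<epsilon>" "0 < r"
  shows "(kernel_defect \<alpha> \<epsilon> has_real_derivative kernel_defect' \<alpha> \<epsilon> r) (at r)"
proof -
  interpret memory_kernel "reg_kernel \<alpha> \<epsilon>" "reg_kernel' \<alpha> \<epsilon>"
    using assms by (intro memory_kernel_reg)
  show ?thesis
    unfolding kernel_defect_def[abs_def] kernel_defect'_def using assms
    by (intro DERIV_diff deriv_k has_real_derivative_powr) auto
qed

text \<open>Writing r^(-\<alpha> - 1) as r (r^2)^(-\<alpha>/2 - 1), the claim is that adding
  \<epsilon>^2 to the base of a negative power decreases it. As a consequence the integral of |d'|
  telescopes.\<close>

lemma kernel_defect'_nonpos:
  assumes "0 < \<alpha>" "0 < r"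
  shows "kernel_defect' \<alpha> \<epsilon> r \<le> 0"
proof -
  have "(r\<^sup>2 + \<epsilon>\<^sup>2) powr (- \<alpha> / 2 - 1) \<le> (r\<^sup>2) powr (- \<alpha> / 2 - 1)"
    using assms by (intro powr_mono2') auto
  also have "\<dots> = r powr (- \<alpha> - 2)"
    using assms by (simp add: powr_powr algebra_simps flip: powr_numeral)
  finally have "\<alpha> * r * (r\<^sup>2 + \<epsilon>\<^sup>2) powr (- \<alpha> / 2 - 1) \<le> \<alpha> * (r * r powr (- \<alpha> - 2))"
    using assms by (simp add: mult.assoc mult_left_mono)
  also have "r * r powr (- \<alpha> - 2) = r powr (- \<alpha> - 1)"
    using assms powr_add[of r 1 "- \<alpha> - 2"] by (simp add: minus_diff_commute[of 1 \<alpha>])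
  finally show ?thesis
    using assms by (simp add: kernel_defect'_def reg_kernel'_def)
qed

lemma continuous_on_kernel_defect':
  assumes "0 < \<alpha>" "0 < \<epsilon>"
  shows "continuous_on {0<..} (kernel_defect' \<alpha> \<epsilon>)"
proof -
  interpret memory_kernel "reg_kernel \<alpha> \<epsilon>" "reg_kernel' \<alpha> \<epsilon>"
    using assms by (intro memory_kernel_reg)
  show ?thesis
    unfolding kernel_defect'_def[abs_def] by (intro continuous_intros) auto
qed

lemma kernel_defect_antimono:
  assumes "0 < \<alpha>" "0 < \<epsilon>" "0 < r" "r \<le> s"
  shows "kernel_defect \<alpha> \<epsilon> s \<le> kernel_defect \<alpha> \<epsilon> r"
proof (rule DERIV_nonpos_imp_nonincreasing[OF assms(4)])
  fix x assume "r \<le> x"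
  then have "0 < x" using assms by simp
  then show "\<exists>y. (kernel_defect \<alpha> \<epsilon> has_real_derivative y) (at x) \<and> y \<le> 0"
    using kernel_defect_deriv[OF assms(1,2)] kernel_defect'_nonpos[OF assms(1)] by blast
qed

text \<open>For \<epsilon> = 0 the integrand is singular at \<eta> = \<tau>, but the antiderivative
  stays continuous there because 1 - \<alpha> > 0, and differentiability in the interior
  suffices.\<close>

lemma has_integral_shifted_powr:
  fixes a \<tau> \<epsilon> \<alpha> :: real
  assumes "\<alpha> < 1" "a \<le> \<tau>" "0 \<le> \<epsilon>"
  shows "((\<lambda>\<eta>. (\<tau> - \<eta> + \<epsilon>) powr (- \<alpha>)) has_integral
    ((\<tau> - a + \<epsilon>) powr (1 - \<alpha>) - \<epsilon> powr (1 - \<alpha>)) / (1 - \<alpha>)) {a..\<tau>}"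
proof -
  define F where "F \<eta> = - ((\<tau> - \<eta> + \<epsilon>) powr (1 - \<alpha>)) / (1 - \<alpha>)" for \<eta>
  have "((\<lambda>\<eta>. (\<tau> - \<eta> + \<epsilon>) powr (- \<alpha>)) has_integral F \<tau> - F a) {a..\<tau>}"
  proof (rule fundamental_theorem_of_calculus_interior[OF assms(2)])
    show "continuous_on {a..\<tau>} F"
      unfolding F_def using assms by (intro continuous_intros continuous_on_powr') auto
    fix x assume x: "x \<in> {a<..<\<tau>}"
    have "((\<lambda>\<eta>. (\<tau> - \<eta> + \<epsilon>) powr (1 - \<alpha>)) has_real_derivative
        - ((1 - \<alpha>) * (\<tau> - x + \<epsilon>) powr (- \<alpha>))) (at x)"
      using x assms by (auto intro!: derivative_eq_intros)
    from DERIV_cdivide[OF DERIV_minus[OF this], of "1 - \<alpha>"]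
    have "(F has_real_derivative (\<tau> - x + \<epsilon>) powr (- \<alpha>)) (at x)"
      unfolding F_def[abs_def] using assms by simp
    then show "(F has_vector_derivative (\<tau> - x + \<epsilon>) powr (- \<alpha>)) (at x)"
      by (simp add: has_real_derivative_iff_has_vector_derivative)
  qed
  then show ?thesis by (simp add: F_def diff_divide_distrib)
qed

text \<open>The defect lies between 0 and r^(-\<alpha>) - (r + \<epsilon>)^(-\<alpha>), and the
  integral of the latter is at most \<epsilon>^(1-\<alpha>)/(1-\<alpha>), whatever the length of the
  interval.\<close>

lemma integral_kernel_defect:
  fixes h :: "real \<Rightarrow> real"
  assumes \<alpha>: "0 < \<alpha>" "\<alpha> < 1" and \<epsilon>: "0 < \<epsilon>" and le: "a \<le> \<tau>"
    and h: "continuous_on {a..\<tau>} h" and B: "\<And>\<eta>. \<eta> \<in> {a..\<tau>} \<Longrightarrow> \<bar>h \<eta>\<bar> \<le> B"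
  shows "(\<lambda>\<eta>. h \<eta> * kernel_defect \<alpha> \<epsilon> (\<tau> - \<eta>)) integrable_on {a..\<tau>}"
    and "\<bar>integral {a..\<tau>} (\<lambda>\<eta>. h \<eta> * kernel_defect \<alpha> \<epsilon> (\<tau> - \<eta>))\<bar>
      \<le> B * (\<epsilon> powr (1 - \<alpha>) / (1 - \<alpha>))"
proof -
  interpret memory_kernel "reg_kernel \<alpha> \<epsilon>" "reg_kernel' \<alpha> \<epsilon>"
    using assms by (intro memory_kernel_reg)
  define f where "f \<eta> = h \<eta> * kernel_defect \<alpha> \<epsilon> (\<tau> - \<eta>)" for \<eta>
  define g where "g \<eta> = B * ((\<tau> - \<eta> + 0) powr (- \<alpha>) - (\<tau> - \<eta> + \<epsilon>) powr (- \<alpha>))" for \<eta>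
  define I where "I = B * (((\<tau> - a + 0) powr (1 - \<alpha>) - 0 powr (1 - \<alpha>)) / (1 - \<alpha>) -
      ((\<tau> - a + \<epsilon>) powr (1 - \<alpha>) - \<epsilon> powr (1 - \<alpha>)) / (1 - \<alpha>))"
  have "(g has_integral I) {a..\<tau>}"
    unfolding g_def[abs_def] I_def
    using \<alpha> \<epsilon> le by (intro has_integral_mult_right has_integral_diff has_integral_shifted_powr) auto
  \<comment> \<open>The endpoint \<eta> = \<tau> is removed: there
    \<open>0 powr (- \<alpha>)\<close> is 0 by convention, so the defect is negative and the bound
    by \<open>g\<close> can fail.\<close>
  then have g: "(g has_integral I) (box a \<tau>)"
    using has_integral_open_interval[of g I a \<tau>] by simp
  have "0 \<le> B" using B[of a] le by (auto intro: order_trans[OF abs_ge_zero])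
  \<comment> \<open>The two terms containing \<tau> - a have a nonpositive difference and are
    dropped from \<open>I\<close>; only \<epsilon>^(1-\<alpha>) survives.\<close>
  have "(\<tau> - a) powr (1 - \<alpha>) \<le> (\<tau> - a + \<epsilon>) powr (1 - \<alpha>)"
    using \<alpha> \<epsilon> le by (intro powr_mono2) auto
  then have I: "I \<le> B * (\<epsilon> powr (1 - \<alpha>) / (1 - \<alpha>))"
    unfolding I_def using \<alpha> \<open>0 \<le> B\<close>
    by (intro mult_left_mono) (auto simp: diff_divide_distrib[symmetric] intro!: divide_right_mono)
  have bound: "norm (f \<eta>) \<le> g \<eta>" if "\<eta> \<in> box a \<tau>" for \<eta>
  proof -
    have "\<bar>h \<eta>\<bar> * kernel_defect \<alpha> \<epsilon> (\<tau> - \<eta>) \<le> B * ((\<tau> - \<eta>) powr (- \<alpha>) - (\<tau> - \<eta> + \<epsilon>) powr (- \<alpha>))"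
      using that \<alpha> \<epsilon> B[of \<eta>] \<open>0 \<le> B\<close> reg_kernel_ge[of \<alpha> "\<tau> - \<eta>" \<epsilon>]
      by (intro mult_mono kernel_defect_nonneg) (auto simp: kernel_defect_def)
    then show ?thesis
      using that \<alpha> kernel_defect_nonneg[of \<alpha> "\<tau> - \<eta>" \<epsilon>] by (simp add: f_def g_def abs_mult)
  qed
  have "continuous_on (box a \<tau>) f"
    unfolding f_def[abs_def] kernel_defect_def
    by (intro continuous_intros continuous_on_subset[OF h]) auto
  then have "f \<in> borel_measurable (lebesgue_on (box a \<tau>))"
    by (rule continuous_imp_measurable_on_sets_lebesgue) simp
  then have f: "f integrable_on box a \<tau>"
    by (rule measurable_bounded_by_integrable_imp_integrable[OF _ has_integral_integrable[OF g] bound]) simp_all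
  then have "f integrable_on {a..\<tau>}"
    using integrable_on_open_interval[of f a \<tau>] by simp
  then show "(\<lambda>\<eta>. h \<eta> * kernel_defect \<alpha> \<epsilon> (\<tau> - \<eta>)) integrable_on {a..\<tau>}"
    by (simp add: f_def[abs_def])
  have "norm (integral (box a \<tau>) f) \<le> integral (box a \<tau>) g"
    using f g bound by (intro integral_norm_bound_integral) auto
  also have "\<dots> = I" using g by blast
  finally show "\<bar>integral {a..\<tau>} (\<lambda>\<eta>. h \<eta> * kernel_defect \<alpha> \<epsilon> (\<tau> - \<eta>))\<bar>
      \<le> B * (\<epsilon> powr (1 - \<alpha>) / (1 - \<alpha>))"
    using I integral_open_interval[of a \<tau> f] by (simp add: f_def[abs_def])
qed

lemma tendsto_powr_at_right_0:
  fixes b :: real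
  assumes "0 < b"
  shows "((\<lambda>\<epsilon>. \<epsilon> powr b) \<longlongrightarrow> 0) (at_right 0)"
proof -
  have "((\<lambda>\<epsilon>::real. \<epsilon> powr b) \<longlongrightarrow> 0 powr b) (at_right 0)"
    using assms by (intro tendsto_powr') (auto intro!: tendsto_intros eventually_at_rightI[of 0 1])
  then show ?thesis by simp
qed

text \<open>Near \<open>\<eta> = 0\<close> nothing is known about the size of \<open>w'\<close>; there the error is integrated
  by parts and controlled by \<open>w\<close> alone. On \<open>[a, \<tau>]\<close> the derivative is bounded and the
  defect of the kernel is small in \<open>L\<^sup>1\<close>.\<close>

lemma caputo_deriv_approx:
  assumes \<alpha>: "0 < \<alpha>" "\<alpha> < 1" and \<epsilon>: "0 < \<epsilon>" and a: "0 < a" "2 * a \<le> \<tau>" "\<tau> \<le> T"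
    and w: "continuous_on {0..T} w"
    and w': "\<And>s. s \<in> {0<..<T} \<Longrightarrow> (w has_real_derivative w' s) (at s)"
    and cont_w': "continuous_on {a..T} w'"
    and W: "\<And>s. s \<in> {0..T} \<Longrightarrow> \<bar>w s\<bar> \<le> W"
    and K: "\<And>s. s \<in> {a..T} \<Longrightarrow> \<bar>w' s\<bar> \<le> K"
  shows "\<bar>Gamma (1 - \<alpha>) * caputo_deriv \<alpha> w \<tau> -
      memory_kernel.regularized_deriv (reg_kernel \<alpha> \<epsilon>) (reg_kernel' \<alpha> \<epsilon>) T w \<tau>\<bar>
    \<le> 2 * W * kernel_defect \<alpha> \<epsilon> a + K * (\<epsilon> powr (1 - \<alpha>) / (1 - \<alpha>))"
proof -
  interpret memory_kernel "reg_kernel \<alpha> \<epsilon>" "reg_kernel' \<alpha> \<epsilon>"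
    using assms by (intro memory_kernel_reg)
  let ?k = "reg_kernel \<alpha> \<epsilon>" and ?k' = "reg_kernel' \<alpha> \<epsilon>"
  let ?d = "kernel_defect \<alpha> \<epsilon>" and ?d' = "kernel_defect' \<alpha> \<epsilon>"
  have \<tau>: "\<tau> \<in> {0..T}" "0 \<le> \<tau>" "a \<le> \<tau>" "0 \<le> a" using a by auto
  have w\<tau>: "continuous_on {0..\<tau>} w" and wa: "continuous_on {0..a} w" 
    using w by (rule continuous_on_subset; use a in auto)+
  have W0: "0 \<le> W" using W[of 0] a by auto

  \<comment> \<open>Integration by parts on all of [0, \<tau>]. The gauge integral of a derivative
    exists as soon as the primitive is continuous, so no bound on \<open>w'\<close> near 0
    enters.\<close>
  have "((\<lambda>\<eta>. w' \<eta> * ?k (\<tau> - \<eta>) - ?k' (\<tau> - \<eta>) * w \<eta>) has_integral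
      w \<tau> * ?k (\<tau> - \<tau>) - w 0 * ?k (\<tau> - 0)) {0..\<tau>}"
  proof (rule fundamental_theorem_of_calculus_interior[OF \<tau>(2)])
    show "continuous_on {0..\<tau>} (\<lambda>\<eta>. w \<eta> * ?k (\<tau> - \<eta>))"
      by (intro continuous_intros w\<tau>)
    fix x assume "x \<in> {0<..<\<tau>}"
    then have "((\<lambda>\<eta>. w \<eta> * ?k (\<tau> - \<eta>)) has_real_derivative
        (w' x * ?k (\<tau> - x) - ?k' (\<tau> - x) * w x)) (at x)"
      using a by (auto intro!: derivative_eq_intros w' DERIV_chain2[OF deriv_k])
    then show "((\<lambda>\<eta>. w \<eta> * ?k (\<tau> - \<eta>)) has_vector_derivative
        (w' x * ?k (\<tau> - x) - ?k' (\<tau> - x) * w x)) (at x)"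
      by (simp add: has_real_derivative_iff_has_vector_derivative)
  qed
  moreover have "((\<lambda>\<eta>. ?k' (\<tau> - \<eta>) * w \<eta>) has_integral
      integral {0..\<tau>} (\<lambda>\<eta>. ?k' (\<tau> - \<eta>) * w \<eta>)) {0..\<tau>}"
    by (intro integrable_integral integrable_continuous_real continuous_intros w\<tau>)
  ultimately have "((\<lambda>\<eta>. w' \<eta> * ?k (\<tau> - \<eta>) - ?k' (\<tau> - \<eta>) * w \<eta> + ?k' (\<tau> - \<eta>) * w \<eta>) has_integral
      w \<tau> * ?k (\<tau> - \<tau>) - w 0 * ?k (\<tau> - 0) + integral {0..\<tau>} (\<lambda>\<eta>. ?k' (\<tau> - \<eta>) * w \<eta>)) {0..\<tau>}"
    by (rule has_integral_add)
  then have main: "((\<lambda>\<eta>. w' \<eta> * ?k (\<tau> - \<eta>)) has_integral regularized_deriv T w \<tau>) {0..\<tau>}"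
    unfolding regularized_deriv_def integral_kernel_truncate[OF w \<tau>(1)]
    by (simp add: algebra_simps)

  have d_comp: "((\<lambda>\<eta>. ?d (\<tau> - \<eta>)) has_real_derivative - ?d' (\<tau> - x)) (at x)" if "x < \<tau>" for x
  proof -
    have "((\<lambda>\<eta>. \<tau> - \<eta>) has_real_derivative - 1) (at x)"
      by (auto intro!: derivative_eq_intros)
    from DERIV_chain2[OF kernel_defect_deriv[OF \<alpha>(1) \<epsilon>] this] that show ?thesis by simp
  qed
  have d_cont: "continuous_on {0..a} (\<lambda>\<eta>. ?d (\<tau> - \<eta>))"
    using a by (intro continuous_at_imp_continuous_on ballI DERIV_isCont[OF d_comp]) auto
  have d'_cont: "continuous_on {0..a} (\<lambda>\<eta>. ?d' (\<tau> - \<eta>))"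
    using a by (intro continuous_on_compose2[OF continuous_on_kernel_defect'[OF \<alpha>(1) \<epsilon>]] continuous_intros) auto

  define I where "I = integral {0..a} (\<lambda>\<eta>. ?d' (\<tau> - \<eta>) * w \<eta>)"
  \<comment> \<open>The same integration by parts with the defect as kernel, on [0, a] only: there
    \<tau> - \<eta> \<ge> a keeps away from the singularity.\<close>
  have "((\<lambda>\<eta>. w' \<eta> * ?d (\<tau> - \<eta>) - ?d' (\<tau> - \<eta>) * w \<eta>) has_integral
      w a * ?d (\<tau> - a) - w 0 * ?d (\<tau> - 0)) {0..a}"
  proof (rule fundamental_theorem_of_calculus_interior[OF \<tau>(4)])
    show "continuous_on {0..a} (\<lambda>\<eta>. w \<eta> * ?d (\<tau> - \<eta>))"
      by (intro continuous_intros wa d_cont)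
    fix x assume "x \<in> {0<..<a}"
    then have "((\<lambda>\<eta>. w \<eta> * ?d (\<tau> - \<eta>)) has_real_derivative
        (w' x * ?d (\<tau> - x) - ?d' (\<tau> - x) * w x)) (at x)"
      using a by (auto intro!: derivative_eq_intros w' d_comp)
    then show "((\<lambda>\<eta>. w \<eta> * ?d (\<tau> - \<eta>)) has_vector_derivative
        (w' x * ?d (\<tau> - x) - ?d' (\<tau> - x) * w x)) (at x)"
      by (simp add: has_real_derivative_iff_has_vector_derivative)
  qed
  moreover have I: "((\<lambda>\<eta>. ?d' (\<tau> - \<eta>) * w \<eta>) has_integral I) {0..a}"
    unfolding I_def by (intro integrable_integral integrable_continuous_real continuous_intros wa d'_cont)
  ultimately have "((\<lambda>\<eta>. w' \<eta> * ?d (\<tau> - \<eta>) - ?d' (\<tau> - \<eta>) * w \<eta> + ?d' (\<tau> - \<eta>) * w \<eta>) has_integral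
      w a * ?d (\<tau> - a) - w 0 * ?d (\<tau> - 0) + I) {0..a}"
    by (rule has_integral_add)
  then have left: "((\<lambda>\<eta>. w' \<eta> * ?d (\<tau> - \<eta>)) has_integral
      w a * ?d (\<tau> - a) - w 0 * ?d \<tau> + I) {0..a}"
    by simp
  have dnn: "0 \<le> ?d r" if "0 < r" for r
    using kernel_defect_nonneg[OF \<alpha>(1) that] .
  \<comment> \<open>Since -d' is nonnegative, this is also the integral of its absolute value, which
    bounds \<open>I\<close> by W times the increment of the defect.\<close>
  have "((\<lambda>\<eta>. - ?d' (\<tau> - \<eta>)) has_integral ?d (\<tau> - a) - ?d (\<tau> - 0)) {0..a}"
  proof (rule fundamental_theorem_of_calculus[OF \<tau>(4)])
    fix x assume "x \<in> {0..a}"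
    with a have "x < \<tau>" by auto
    then show "((\<lambda>\<eta>. ?d (\<tau> - \<eta>)) has_vector_derivative - ?d' (\<tau> - x)) (at x within {0..a})"
      using d_comp[of x]
      by (simp add: has_real_derivative_iff_has_vector_derivative has_vector_derivative_at_within)
  qed
  from has_integral_mult_right[OF this, of W]
  have D: "((\<lambda>\<eta>. W * - ?d' (\<tau> - \<eta>)) has_integral W * (?d (\<tau> - a) - ?d \<tau>)) {0..a}"
    by simp
  have "norm I \<le> W * (?d (\<tau> - a) - ?d \<tau>)"
    unfolding I_def integral_unique[OF D, symmetric]
  proof (rule integral_norm_bound_integral)
    fix \<eta> assume \<eta>: "\<eta> \<in> {0..a}"
    have "- ?d' (\<tau> - \<eta>) * \<bar>w \<eta>\<bar> \<le> - ?d' (\<tau> - \<eta>) * W"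
      using \<eta> a kernel_defect'_nonpos[OF \<alpha>(1), of "\<tau> - \<eta>" \<epsilon>] by (intro mult_left_mono W) auto
    then show "norm (?d' (\<tau> - \<eta>) * w \<eta>) \<le> W * - ?d' (\<tau> - \<eta>)"
      using \<eta> a kernel_defect'_nonpos[OF \<alpha>(1), of "\<tau> - \<eta>" \<epsilon>] by (simp add: abs_mult mult.commute)
  qed (use I D in blast)+
  moreover have "\<bar>w a * ?d (\<tau> - a)\<bar> \<le> W * ?d (\<tau> - a)" "\<bar>w 0 * ?d \<tau>\<bar> \<le> W * ?d \<tau>"
    using a dnn W[of a] W[of 0] by (auto simp: abs_mult intro!: mult_right_mono)
  \<comment> \<open>Here 2a \<le> \<tau> is used: \<tau> - a \<ge> a and the defect is
    nonincreasing. With it the three contributions add up to 2 W d(\<tau> - a) \<le> 2 W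
    d(a).\<close>
  moreover have "W * ?d (\<tau> - a) \<le> W * ?d a"
    using a \<alpha> \<epsilon> W0 by (intro mult_left_mono kernel_defect_antimono) auto
  ultimately have left_bound: "\<bar>w a * ?d (\<tau> - a) - w 0 * ?d \<tau> + I\<bar> \<le> 2 * W * ?d a"
    by (simp add: algebra_simps)

  have cw: "continuous_on {a..\<tau>} w'"
    using cont_w' by (rule continuous_on_subset) (use a in auto)
  define R where "R = integral {a..\<tau>} (\<lambda>\<eta>. w' \<eta> * ?d (\<tau> - \<eta>))"
  have right: "((\<lambda>\<eta>. w' \<eta> * ?d (\<tau> - \<eta>)) has_integral R) {a..\<tau>}"
    and right_bound: "\<bar>R\<bar> \<le> K * (\<epsilon> powr (1 - \<alpha>) / (1 - \<alpha>))"
    using integral_kernel_defect[OF \<alpha> \<epsilon> \<tau>(3) cw, of K] K a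
    unfolding R_def by (auto intro: integrable_integral)

  have "((\<lambda>\<eta>. w' \<eta> * ?d (\<tau> - \<eta>)) has_integral (w a * ?d (\<tau> - a) - w 0 * ?d \<tau> + I) + R) {0..\<tau>}"
    by (rule has_integral_combine[OF \<tau>(4,3) left right])
  from has_integral_add[OF main this]
  have "((\<lambda>\<eta>. w' \<eta> * (\<tau> - \<eta>) powr (- \<alpha>)) has_integral
      regularized_deriv T w \<tau> + ((w a * ?d (\<tau> - a) - w 0 * ?d \<tau> + I) + R)) {0..\<tau>}"
    by (simp add: kernel_defect_def algebra_simps)
  \<comment> \<open>\<open>deriv w\<close> is known to equal \<open>w'\<close> only inside (0, T),
    so the two endpoints, 0 and possibly \<tau> = T, are discarded as a finite set.\<close>
  then have "((\<lambda>\<eta>. deriv w \<eta> * (\<tau> - \<eta>) powr (- \<alpha>)) has_integral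
      regularized_deriv T w \<tau> + ((w a * ?d (\<tau> - a) - w 0 * ?d \<tau> + I) + R)) {0..\<tau>}"
    by (rule has_integral_spike_finite[rotated 2, where S = "{0, \<tau>}"])
      (use a w' in \<open>auto simp: DERIV_imp_deriv\<close>)
  moreover have "Gamma (1 - \<alpha>) \<noteq> 0"
    using less_imp_neq[OF Gamma_real_pos[of "1 - \<alpha>"]] \<alpha> by simp
  ultimately have "Gamma (1 - \<alpha>) * caputo_deriv \<alpha> w \<tau> =
      regularized_deriv T w \<tau> + ((w a * ?d (\<tau> - a) - w 0 * ?d \<tau> + I) + R)"
    by (simp add: caputo_deriv_def integral_unique)
  then show ?thesis using left_bound right_bound by linarith
qed

lemma memory_reg_approx:
  assumes \<alpha>: "0 < \<alpha>" "\<alpha> < 1" and \<epsilon>: "0 < \<epsilon>" and t: "0 \<le> t"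
    and G: "continuous_on {0..t} G" and B: "\<And>s. s \<in> {0..t} \<Longrightarrow> \<bar>G s\<bar> \<le> B"
  shows "\<bar>Gamma (1 - \<alpha>) * RL_integral \<alpha> G t - memory_kernel.memory (reg_kernel \<alpha> \<epsilon>) G t\<bar>
    \<le> B * (\<epsilon> powr (1 - \<alpha>) / (1 - \<alpha>))"
proof -
  interpret memory_kernel "reg_kernel \<alpha> \<epsilon>" "reg_kernel' \<alpha> \<epsilon>"
    using assms by (intro memory_kernel_reg)
  let ?k = "reg_kernel \<alpha> \<epsilon>" and ?d = "kernel_defect \<alpha> \<epsilon>"
  define R where "R = integral {0..t} (\<lambda>\<eta>. G \<eta> * ?d (t - \<eta>))"
  have R: "((\<lambda>\<eta>. G \<eta> * ?d (t - \<eta>)) has_integral R) {0..t}"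
    and R_bound: "\<bar>R\<bar> \<le> B * (\<epsilon> powr (1 - \<alpha>) / (1 - \<alpha>))"
    using integral_kernel_defect[OF \<alpha> \<epsilon> t G B] unfolding R_def by (auto intro: integrable_integral)
  have M: "((\<lambda>\<eta>. ?k (t - \<eta>) * G \<eta>) has_integral memory G t) {0..t}"
    unfolding memory_def by (intro integrable_integral integrable_continuous_real continuous_intros G)
  have "((\<lambda>\<eta>. (t - \<eta>) powr (- \<alpha>) * G \<eta>) has_integral memory G t + R) {0..t}"
    using has_integral_add[OF M R] by (simp add: kernel_defect_def algebra_simps)
  moreover have "Gamma (1 - \<alpha>) \<noteq> 0"
    using less_imp_neq[OF Gamma_real_pos[of "1 - \<alpha>"]] \<alpha> by simp
  ultimately have "Gamma (1 - \<alpha>) * RL_integral \<alpha> G t = memory G t + R"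
    by (simp add: RL_integral_def integral_unique)
  then show ?thesis using R_bound by simp
qed

text \<open>A bound uniform in \<epsilon> that vanishes as t tends to 0; it disposes of the memory
  at the lower end 2a of the time integration.\<close>

lemma memory_reg_bound:
  assumes \<alpha>: "0 < \<alpha>" "\<alpha> < 1" and \<epsilon>: "0 < \<epsilon>" and t: "0 \<le> t"
    and G: "continuous_on {0..t} G" and B: "\<And>s. s \<in> {0..t} \<Longrightarrow> \<bar>G s\<bar> \<le> B"
  shows "\<bar>memory_kernel.memory (reg_kernel \<alpha> \<epsilon>) G t\<bar> \<le> B * (t powr (1 - \<alpha>) / (1 - \<alpha>))"
proof -
  interpret memory_kernel "reg_kernel \<alpha> \<epsilon>" "reg_kernel' \<alpha> \<epsilon>"
    using assms by (intro memory_kernel_reg)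
  let ?k = "reg_kernel \<alpha> \<epsilon>"
  have P: "((\<lambda>\<eta>. B * (t - \<eta> + 0) powr (- \<alpha>)) has_integral
      B * (((t - 0 + 0) powr (1 - \<alpha>) - 0 powr (1 - \<alpha>)) / (1 - \<alpha>))) (box 0 t)"
    unfolding has_integral_open_interval cbox_interval
    using \<alpha> t by (intro has_integral_mult_right has_integral_shifted_powr) auto
  have i: "(\<lambda>\<eta>. ?k (t - \<eta>) * G \<eta>) integrable_on {0..t}"
    by (intro integrable_continuous_real continuous_intros G)
  have "norm (integral (box 0 t) (\<lambda>\<eta>. ?k (t - \<eta>) * G \<eta>)) \<le>
      integral (box 0 t) (\<lambda>\<eta>. B * (t - \<eta> + 0) powr (- \<alpha>))"
  proof (rule integral_norm_bound_integral)
    show "(\<lambda>\<eta>. ?k (t - \<eta>) * G \<eta>) integrable_on box 0 t"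
      using i unfolding integrable_on_open_interval cbox_interval .
    fix \<eta> assume "\<eta> \<in> box 0 t"
    then have "?k (t - \<eta>) * \<bar>G \<eta>\<bar> \<le> (t - \<eta>) powr (- \<alpha>) * B"
      using \<alpha> by (intro mult_mono reg_kernel_le B) auto
    then show "norm (?k (t - \<eta>) * G \<eta>) \<le> B * (t - \<eta> + 0) powr (- \<alpha>)"
      by (simp add: abs_mult k_nonneg mult.commute)
  qed (use P in blast)
  also have "\<dots> = B * (t powr (1 - \<alpha>) / (1 - \<alpha>))"
    using integral_unique[OF P] by simp
  finally show ?thesis
    unfolding memory_def integral_open_interval cbox_interval by simp
qed

section \<open>Energy of a regular function with Dirichlet boundary values\<close>

lemma norm0_sq_nonneg: "0 \<le> norm0_sq l v"
  \<comment> \<open>When the square is not integrable, the integral has the default value 0.\<close>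
  unfolding norm0_sq_def by (cases "(\<lambda>x. (v x)\<^sup>2) integrable_on {0..l}")
    (auto intro: Henstock_Kurzweil_Integration.integral_nonneg simp: not_integrable_integral)

locale regular_dirichlet =
  fixes l T :: real and u :: "real \<Rightarrow> real \<Rightarrow> real"
  assumes l_pos: "0 < l" and T_pos: "0 < T"
    and regular: "regular_on_rectangle l T u"
    and boundary: "\<And>t. t \<in> {0..T} \<Longrightarrow> u 0 t = 0" "\<And>t. t \<in> {0..T} \<Longrightarrow> u l t = 0"
begin

abbreviation "ux \<equiv> partial_x l u"
abbreviation "uxx \<equiv> partial_x l ux"
abbreviation "ut \<equiv> partial_t T u"
abbreviation "uxxt \<equiv> partial_t T uxx"

definition mass :: "real \<Rightarrow> real" where "mass t = norm0_sq l (\<lambda>x. u x t)"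
definition energy :: "real \<Rightarrow> real" where "energy t = norm0_sq l (\<lambda>x. ux x t)"

lemma cont_u: "continuous_on ({0..l} \<times> {0..T}) (\<lambda>(x, t). u x t)"
  and cont_ux: "continuous_on ({0..l} \<times> {0..T}) (\<lambda>(x, t). ux x t)"
  and cont_uxx: "continuous_on ({0..l} \<times> {0<..T}) (\<lambda>(x, t). uxx x t)"
  and cont_ut: "continuous_on ({0..l} \<times> {0<..T}) (\<lambda>(x, t). ut x t)"
  and cont_uxxt: "continuous_on ({0..l} \<times> {0<..T}) (\<lambda>(x, t). uxxt x t)"
  using regular unfolding regular_on_rectangle_def by blast+

lemmas cont_u_comp = continuous_on_curried[OF cont_u]
  and cont_ux_comp = continuous_on_curried[OF cont_ux]
  and cont_uxx_comp = continuous_on_curried[OF cont_uxx]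
  and cont_ut_comp = continuous_on_curried[OF cont_ut]
  and cont_uxxt_comp = continuous_on_curried[OF cont_uxxt]

lemma deriv_ux:
  assumes "x \<in> {0..l}" "t \<in> {0..T}"
  shows "((\<lambda>y. u y t) has_real_derivative ux x t) (at x within {0..l})"
  using regular assms unfolding regular_on_rectangle_def partial_x_def
  by (metis has_real_derivative_iff_has_vector_derivative vector_derivative_works)

lemma deriv_uxx:
  assumes "x \<in> {0..l}" "t \<in> {0<..T}"
  shows "((\<lambda>y. ux y t) has_real_derivative uxx x t) (at x within {0..l})"
proof -
  have "(\<lambda>y. ux y t) differentiable (at x within {0..l})"
    using regular assms unfolding regular_on_rectangle_def by blast
  then show ?thesis
    unfolding partial_x_def[of l ux]
    by (simp add: has_real_derivative_iff_has_vector_derivative vector_derivative_works)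
qed

lemma deriv_ut:
  assumes "x \<in> {0..l}" "t \<in> {0<..T}"
  shows "((\<lambda>s. u x s) has_real_derivative ut x t) (at t within {0..T})"
proof -
  have "(\<lambda>s. u x s) differentiable (at t within {0..T})"
    using regular assms unfolding regular_on_rectangle_def by blast
  then show ?thesis
    unfolding partial_t_def
    by (simp add: has_real_derivative_iff_has_vector_derivative vector_derivative_works)
qed

lemma deriv_uxxt:
  assumes "x \<in> {0..l}" "t \<in> {0<..T}"
  shows "((\<lambda>s. uxx x s) has_real_derivative uxxt x t) (at t within {0..T})"
proof -
  have "(\<lambda>s. uxx x s) differentiable (at t within {0..T})"
    using regular assms unfolding regular_on_rectangle_def by blast
  then show ?thesis
    unfolding partial_t_def
    by (simp add: has_real_derivative_iff_has_vector_derivative vector_derivative_works)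
qed

lemma bounded_u:
  obtains W where "\<And>x t. x \<in> {0..l} \<Longrightarrow> t \<in> {0..T} \<Longrightarrow> \<bar>u x t\<bar> \<le> W"
proof -
  have "bounded ((\<lambda>(x, t). u x t) ` ({0..l} \<times> {0..T}))"
    by (intro compact_imp_bounded compact_continuous_image cont_u compact_Times compact_Icc)
  then have "\<exists>W. \<forall>x\<in>{0..l}. \<forall>t\<in>{0..T}. \<bar>u x t\<bar> \<le> W"
    unfolding bounded_iff by fastforce
  then show ?thesis using that by blast
qed

lemma mass_nonneg: "0 \<le> mass t"
  by (simp add: mass_def norm0_sq_nonneg)

lemma energy_nonneg: "0 \<le> energy t"
  by (simp add: energy_def norm0_sq_nonneg)

lemma continuous_on_mass: "continuous_on {0..T} mass"
proof -
  have "continuous_on {0..T} (\<lambda>t. integral (cbox 0 l) (\<lambda>x. (u x t)\<^sup>2))"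
    by (rule integral_continuous_on_param)
      (unfold case_prod_beta, intro continuous_intros cont_u_comp, auto)
  then show ?thesis unfolding mass_def[abs_def] norm0_sq_def by simp
qed

lemma continuous_on_energy: "continuous_on {0..T} energy"
proof -
  have "continuous_on {0..T} (\<lambda>t. integral (cbox 0 l) (\<lambda>x. (ux x t)\<^sup>2))"
    by (rule integral_continuous_on_param)
      (unfold case_prod_beta, intro continuous_intros cont_ux_comp, auto)
  then show ?thesis unfolding energy_def[abs_def] norm0_sq_def by simp
qed

text \<open>Expand \<open>\<integral>\<^sub>0\<^sup>x (u\<^sub>y - u(x)/x)\<^sup>2 dy \<ge> 0\<close>; this gives the sharp constant without the
  Cauchy--Schwarz inequality.\<close>

lemma square_le_energy:
  assumes x: "x \<in> {0..l}" and t: "t \<in> {0..T}"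
  shows "(u x t)\<^sup>2 \<le> l * energy t"
proof (cases "x = 0")
  case True
  then show ?thesis using boundary t l_pos energy_nonneg[of t] by simp
next
  case False
  with x have x0: "0 < x" "x \<le> l" by auto
  define c where "c = u x t / x"
  define I where "I = integral {0..x} (\<lambda>y. (ux y t)\<^sup>2)"
  have I: "((\<lambda>y. (ux y t)\<^sup>2) has_integral I) {0..x}"
    unfolding I_def using t x0
    by (intro integrable_integral integrable_continuous_real continuous_intros cont_ux_comp) auto
  have "((\<lambda>y. ux y t) has_integral u x t - u 0 t) {0..x}"
    using x0 t by (intro fundamental_theorem_of_calculus)
      (auto simp flip: has_real_derivative_iff_has_vector_derivative intro: DERIV_subset[OF deriv_ux])
  then have J: "((\<lambda>y. ux y t) has_integral u x t) {0..x}"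
    using boundary t by simp
  have K: "((\<lambda>y. c\<^sup>2) has_integral x * c\<^sup>2) {0..x}"
    using has_integral_const_real[of "c\<^sup>2" 0 x] x0 by simp
  have "((\<lambda>y. (ux y t)\<^sup>2 - 2 * c * ux y t + c\<^sup>2) has_integral I - 2 * c * u x t + x * c\<^sup>2) {0..x}"
    by (intro has_integral_add has_integral_diff has_integral_mult_right I J K)
  moreover have "0 \<le> (ux y t)\<^sup>2 - 2 * c * ux y t + c\<^sup>2" for y
    using zero_le_power2[of "ux y t - c"] by (simp add: power2_diff algebra_simps)
  ultimately have "0 \<le> I - 2 * c * u x t + x * c\<^sup>2"
    by (rule has_integral_nonneg)
  then have "(u x t)\<^sup>2 \<le> x * I"
    using x0 by (simp add: c_def field_simps power2_eq_square)
  also have "I \<le> energy t"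
    unfolding I_def energy_def norm0_sq_def using x0 t
    by (intro integral_subset_le integrable_continuous_real continuous_intros cont_ux_comp) auto
  then have "x * I \<le> l * energy t"
    using x0 energy_nonneg[of t] l_pos
    by (intro mult_mono) (auto simp: I_def intro!: Henstock_Kurzweil_Integration.integral_nonneg has_integral_integrable[OF I])
  finally show ?thesis .
qed

text \<open>Two independent times are kept so that the pairing of u(t) with u_xx(s) is seen to be
  symmetric in s and t.\<close>

lemma integral_by_parts_x:
  assumes s: "s \<in> {0<..T}" and t: "t \<in> {0..T}"
  shows "integral {0..l} (\<lambda>x. u x t * uxx x s) = - integral {0..l} (\<lambda>x. ux x t * ux x s)"
proof -
  have i1: "(\<lambda>x. u x t * uxx x s) integrable_on {0..l}" and i2: "(\<lambda>x. ux x t * ux x s) integrable_on {0..l}"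
    using s t by (intro integrable_continuous_real continuous_intros cont_u_comp cont_ux_comp cont_uxx_comp; auto)+
  have "((\<lambda>x. ux x t * ux x s + u x t * uxx x s) has_integral u l t * ux l s - u 0 t * ux 0 s) {0..l}"
  proof (rule fundamental_theorem_of_calculus)
    fix x assume "x \<in> {0..l}"
    then have "((\<lambda>x. u x t * ux x s) has_real_derivative ux x t * ux x s + u x t * uxx x s) (at x within {0..l})"
      using s t by (auto intro!: derivative_eq_intros deriv_ux deriv_uxx)
    then show "((\<lambda>x. u x t * ux x s) has_vector_derivative ux x t * ux x s + u x t * uxx x s) (at x within {0..l})"
      by (simp add: has_real_derivative_iff_has_vector_derivative)
  qed (use l_pos in simp)
  then have "integral {0..l} (\<lambda>x. ux x t * ux x s + u x t * uxx x s) = 0"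
    using boundary t by (simp add: integral_unique)
  then show ?thesis
    using Henstock_Kurzweil_Integration.integral_add[OF i2 i1] by simp
qed

lemma energy_eq:
  assumes "t \<in> {0<..T}"
  shows "energy t = - integral {0..l} (\<lambda>x. u x t * uxx x t)"
  using integral_by_parts_x[OF assms, of t] assms by (simp add: energy_def norm0_sq_def power2_eq_square)

text \<open>No mixed derivative u_xt is available for a direct integration by parts. Instead the
  symmetric pairing of u(t) with u_xx(s) is differentiated in each of its two time slots; symmetry
  forces the results to agree.\<close>

lemma integral_ut_uxx:
  assumes s: "s \<in> {0<..T}"
  shows "integral {0..l} (\<lambda>x. ut x s * uxx x s) = integral {0..l} (\<lambda>x. u x s * uxxt x s)"
proof -
  have "((\<lambda>t. integral (cbox 0 l) (\<lambda>x. u x t * uxx x s)) has_real_derivative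
      integral (cbox 0 l) (\<lambda>x. ut x s * uxx x s)) (at s within {0<..T})"
  proof (rule leibniz_rule_field_derivative[where fx = "\<lambda>t x. ut x t * uxx x s"])
    fix t x assume tx: "t \<in> {0<..T}" "x \<in> cbox 0 l"
    then show "((\<lambda>t. u x t * uxx x s) has_real_derivative ut x t * uxx x s) (at t within {0<..T})"
      by (auto intro!: derivative_eq_intros DERIV_subset[OF deriv_ut])
  next
    show "continuous_on ({0<..T} \<times> cbox 0 l) (\<lambda>(t, x). ut x t * uxx x s)"
      using s by (unfold case_prod_beta, intro continuous_intros cont_ut_comp cont_uxx_comp) auto
  next
    fix t assume "t \<in> {0<..T}"
    then show "(\<lambda>x. u x t * uxx x s) integrable_on cbox 0 l"
      using s unfolding cbox_interval
      by (intro integrable_continuous_real continuous_intros cont_u_comp cont_uxx_comp) auto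
  qed (use s in auto)
  moreover have "((\<lambda>t. integral (cbox 0 l) (\<lambda>x. u x s * uxx x t)) has_real_derivative
      integral (cbox 0 l) (\<lambda>x. u x s * uxxt x s)) (at s within {0<..T})"
  proof (rule leibniz_rule_field_derivative[where fx = "\<lambda>t x. u x s * uxxt x t"])
    fix t x assume tx: "t \<in> {0<..T}" "x \<in> cbox 0 l"
    then show "((\<lambda>t. u x s * uxx x t) has_real_derivative u x s * uxxt x t) (at t within {0<..T})"
      by (auto intro!: derivative_eq_intros DERIV_subset[OF deriv_uxxt])
  next
    show "continuous_on ({0<..T} \<times> cbox 0 l) (\<lambda>(t, x). u x s * uxxt x t)"
      using s by (unfold case_prod_beta, intro continuous_intros cont_u_comp cont_uxxt_comp) auto
  next
    fix t assume "t \<in> {0<..T}"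
    then show "(\<lambda>x. u x s * uxx x t) integrable_on cbox 0 l"
      using s unfolding cbox_interval
      by (intro integrable_continuous_real continuous_intros cont_u_comp cont_uxx_comp) auto
  qed (use s in auto)
  then have "((\<lambda>t. integral (cbox 0 l) (\<lambda>x. u x t * uxx x s)) has_real_derivative
      integral (cbox 0 l) (\<lambda>x. u x s * uxxt x s)) (at s within {0<..T})"
    unfolding has_real_derivative_iff_has_vector_derivative
  proof (rule has_vector_derivative_transform[OF s, rotated])
    fix t assume t: "t \<in> {0<..T}"
    show "integral (cbox 0 l) (\<lambda>x. u x t * uxx x s) = integral (cbox 0 l) (\<lambda>x. u x s * uxx x t)"
      using integral_by_parts_x[OF s, of t] integral_by_parts_x[OF t, of s] s t
      by (simp add: mult.commute)
  qed
  \<comment> \<open>Uniqueness of the derivative within a set requires s to be a limit point of it,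
    also at s = T.\<close>
  moreover have "at s within {0<..T} \<noteq> bot"
  proof -
    have "s islimpt {0<..<s}" using s by (intro islimpt_greaterThanLessThan2) auto
    then have "s islimpt {0<..T}" using s by (auto elim: islimpt_subset)
    then show ?thesis by (simp add: trivial_limit_within)
  qed
  ultimately show ?thesis
    using has_field_derivative_unique by fastforce
qed

text \<open>For positive times the energy is minus the integral of u u_xx. The product rule yields
  two terms, which coincide by \<open>integral_ut_uxx\<close>.\<close>

lemma energy_has_derivative:
  assumes s: "s \<in> {0<..T}"
  shows "(energy has_real_derivative - 2 * integral {0..l} (\<lambda>x. u x s * uxxt x s)) (at s within {0<..T})"
proof -
  have "((\<lambda>t. integral (cbox 0 l) (\<lambda>x. u x t * uxx x t)) has_real_derivative
      integral (cbox 0 l) (\<lambda>x. ut x s * uxx x s + u x s * uxxt x s)) (at s within {0<..T})"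
  proof (rule leibniz_rule_field_derivative)
    fix t x assume tx: "t \<in> {0<..T}" "x \<in> cbox 0 l"
    then show "((\<lambda>t. u x t * uxx x t) has_real_derivative ut x t * uxx x t + u x t * uxxt x t) (at t within {0<..T})"
      by (auto intro!: derivative_eq_intros DERIV_subset[OF deriv_ut] DERIV_subset[OF deriv_uxxt])
  next
    show "continuous_on ({0<..T} \<times> cbox 0 l) (\<lambda>(t, x). ut x t * uxx x t + u x t * uxxt x t)"
      by (unfold case_prod_beta, intro continuous_intros cont_u_comp cont_ut_comp cont_uxx_comp cont_uxxt_comp) auto
  next
    fix t assume "t \<in> {0<..T}"
    then show "(\<lambda>x. u x t * uxx x t) integrable_on cbox 0 l"
      unfolding cbox_interval
      by (intro integrable_continuous_real continuous_intros cont_u_comp cont_uxx_comp) auto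
  qed (use s in auto)
  moreover have "integral (cbox 0 l) (\<lambda>x. ut x s * uxx x s + u x s * uxxt x s) =
      2 * integral {0..l} (\<lambda>x. u x s * uxxt x s)"
  proof -
    have "(\<lambda>x. ut x s * uxx x s) integrable_on {0..l}" "(\<lambda>x. u x s * uxxt x s) integrable_on {0..l}"
      using s by (intro integrable_continuous_real continuous_intros cont_u_comp cont_ut_comp
          cont_uxx_comp cont_uxxt_comp; auto)+
    then show ?thesis
      by (simp add: Henstock_Kurzweil_Integration.integral_add integral_ut_uxx[OF s])
  qed
  ultimately have "((\<lambda>t. - integral {0..l} (\<lambda>x. u x t * uxx x t)) has_real_derivative
      - 2 * integral {0..l} (\<lambda>x. u x s * uxxt x s)) (at s within {0<..T})"
    using DERIV_minus by fastforce
  then show ?thesis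
    unfolding has_real_derivative_iff_has_vector_derivative
    by (rule has_vector_derivative_transform[OF s, rotated]) (rule energy_eq)
qed

end

section \<open>Time slices of a square integrable function\<close>

lemma square_integrable_section:
  assumes f: "square_integrable_on_rectangle l T f" and t: "t \<in> {0<..<T}"
    and B: "\<And>x. x \<in> {0<..<l} \<Longrightarrow> \<bar>f x t\<bar> \<le> B"
  shows "set_integrable lborel {0<..<l} (\<lambda>x. (f x t)\<^sup>2)"
proof -
  have M: "(\<lambda>z. indicator ({0<..<l} \<times> {0<..<T}) z *\<^sub>R (case z of (x, t) \<Rightarrow> f x t)) \<in> borel_measurable borel"
    using f by (simp add: square_integrable_on_rectangle_def set_borel_measurable_def)
  have N: "(\<lambda>x. (x, t)) \<in> borel_measurable borel"
    by (intro borel_measurable_continuous_onI continuous_intros)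
  have "(\<lambda>x. indicator ({0<..<l} \<times> {0<..<T}) (x, t) *\<^sub>R f x t) \<in> borel_measurable borel"
    using measurable_compose[OF N M] by simp
  then have [measurable]: "(\<lambda>x. indicator {0<..<l} x * f x t) \<in> borel_measurable borel"
    using t by (simp add: indicator_times)
  \<comment> \<open>A bounded measurable function on an interval of finite length. This gives
    integrability at the given t itself, whereas Fubini would give it for almost every t
    only.\<close>
  have "integrable lborel (\<lambda>x. indicator {0<..<l} x *\<^sub>R (indicator {0<..<l} x * f x t)\<^sup>2)"
  proof (rule integrableI_bounded_set_indicator[where B = "B\<^sup>2"])
    show "AE x in lborel. x \<in> {0<..<l} \<longrightarrow> norm ((indicator {0<..<l} x * f x t)\<^sup>2) \<le> B\<^sup>2"
    proof (intro AE_I2 impI)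
      fix x assume "x \<in> {0<..<l}"
      then show "norm ((indicator {0<..<l} x * f x t)\<^sup>2) \<le> B\<^sup>2"
        using B[of x] power_mono[of "\<bar>f x t\<bar>" B 2] by simp
    qed
  next
    show "emeasure lborel {0<..<l} < \<infinity>"
      by (rule emeasure_bounded_finite) (simp add: bounded_subset[OF bounded_cbox[of 0 l]] subset_iff)
  qed auto
  moreover have "indicator {0<..<l} x *\<^sub>R (indicator {0<..<l} x * f x t)\<^sup>2 =
      indicator {0<..<l} x *\<^sub>R (f x t)\<^sup>2" for x
    by (simp add: indicator_def)
  ultimately show ?thesis unfolding set_integrable_def by (simp only:)
qed

lemma norm0_sq_section:
  assumes "set_integrable lborel {0<..<l} (\<lambda>x. (v x)\<^sup>2)"
  shows "(\<lambda>x. (v x)\<^sup>2) integrable_on {0..l}"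
    and "norm0_sq l v = (LINT x|lborel. indicator {0<..<l} x * (v x)\<^sup>2)"
  using set_borel_integral_eq_integral[OF assms] integrable_on_open_interval[of "\<lambda>x. (v x)\<^sup>2" 0 l]
    integral_open_interval[of 0 l "\<lambda>x. (v x)\<^sup>2"]
  by (simp_all add: norm0_sq_def set_lebesgue_integral_def)

text \<open>Fubini makes the Lebesgue integral in x an integrable function of t; integrability of
  every slice identifies that integral with the gauge integral in \<open>norm0_sq\<close>.\<close>

lemma norm0_sq_integrable_in_time:
  assumes f: "square_integrable_on_rectangle l T f"
    and sec: "\<And>t. t \<in> {0<..<T} \<Longrightarrow> set_integrable lborel {0<..<l} (\<lambda>x. (f x t)\<^sup>2)"
  shows "(\<lambda>t. norm0_sq l (\<lambda>x. f x t)) integrable_on {0..T}"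
proof -
  let ?g = "\<lambda>x t. indicator ({0<..<l} \<times> {0<..<T}) (x, t) * (f x t)\<^sup>2"
  have "integrable (lborel \<Otimes>\<^sub>M lborel) (\<lambda>(x, t). ?g x t)"
    using f unfolding square_integrable_on_rectangle_def set_integrable_def lborel_prod
    by (simp add: case_prod_beta')
  then have "integrable lborel (\<lambda>t. LINT x|lborel. ?g x t)"
    by (rule lborel_pair.integrable_snd)
  moreover have "(LINT x|lborel. ?g x t) = indicator {0<..<T} t *\<^sub>R norm0_sq l (\<lambda>x. f x t)" for t
    using norm0_sq_section(2)[OF sec, of t]
    by (cases "t \<in> {0<..<T}") (auto simp: indicator_times)
  ultimately have "set_integrable lborel {0<..<T} (\<lambda>t. norm0_sq l (\<lambda>x. f x t))"
    by (simp add: set_integrable_def)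
  from set_borel_integral_eq_integral(1)[OF this] show ?thesis
    using integrable_on_open_interval[of "\<lambda>t. norm0_sq l (\<lambda>x. f x t)" 0 T] by simp
qed

lemma gronwall_integral:
  fixes E :: "real \<Rightarrow> real"
  assumes E: "continuous_on {0..t} E" and t: "0 \<le> t" and c: "0 < c" and d: "0 < d"
    and le: "\<And>s. s \<in> {0..t} \<Longrightarrow> d * E s \<le> A + c * integral {0..s} E"
  shows "A + c * integral {0..t} E \<le> A * exp (c / d * t)"
proof -
  \<comment> \<open>Integrating factor: the hypothesis says precisely that the derivative of
    \<open>z\<close> is nonpositive, so \<open>z\<close> at t is at most its initial value
    A.\<close>
  define z where "z s = (A + c * integral {0..s} E) * exp (- (c / d) * s)" for s
  have "(z has_real_derivative c * (E s - (A + c * integral {0..s} E) / d) * exp (- (c / d) * s))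
      (at s within {0..t})" if "s \<in> {0..t}" for s
  proof -
    have "((\<lambda>s. A + c * integral {0..s} E) has_real_derivative 0 + c * E s) (at s within {0..t})"
      by (intro DERIV_add DERIV_const DERIV_cmult integral_has_real_derivative[OF E that])
    moreover have "((\<lambda>s. exp (- (c / d) * s)) has_real_derivative
        exp (- (c / d) * s) * (- (c / d) * 1)) (at s within {0..t})"
      by (rule DERIV_chain2[OF DERIV_exp DERIV_cmult[OF DERIV_ident]])
    ultimately have "(z has_real_derivative (0 + c * E s) * exp (- (c / d) * s) +
        (exp (- (c / d) * s) * (- (c / d) * 1)) * (A + c * integral {0..s} E)) (at s within {0..t})"
      unfolding z_def[abs_def] by (rule DERIV_mult)
    then show ?thesis
      by (rule back_subst[where P = "\<lambda>D. (z has_real_derivative D) (at s within {0..t})"])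
        (use d in \<open>simp add: algebra_simps\<close>)
  qed
  moreover have nonpos: "c * (E s - (A + c * integral {0..s} E) / d) * exp (- (c / d) * s) \<le> 0" if "s \<in> {0..t}" for s
  proof -
    have "E s - (A + c * integral {0..s} E) / d \<le> 0"
      using le[OF that] d by (simp add: field_simps)
    then show ?thesis using c by (intro mult_nonpos_nonneg mult_nonneg_nonpos) auto
  qed
  ultimately have "((\<lambda>s. c * (E s - (A + c * integral {0..s} E) / d) * exp (- (c / d) * s)) has_integral z t - z 0) {0..t}"
    unfolding has_real_derivative_iff_has_vector_derivative
    by (intro fundamental_theorem_of_calculus t)
  from has_integral_le[OF this has_integral_0 nonpos] have "z t \<le> z 0"
    by simp
  then have "(A + c * integral {0..t} E) * exp (- (c / d) * t) \<le> A"
    by (simp add: z_def)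
  from mult_right_mono[OF this, of "exp (c / d * t)"] show ?thesis
    by (simp add: mult.assoc flip: exp_add)
qed

section \<open>The energy inequality for solutions\<close>

text \<open>The initial data enter through \<open>mass 0\<close> and \<open>energy 0\<close>; the
  final theorem translates these into norms of \<open>u0\<close> and its derivative.\<close>

locale fractional_solution = regular_dirichlet l T u
  for l T :: real and u :: "real \<Rightarrow> real \<Rightarrow> real" +
  fixes \<alpha> \<mu> c1 :: real and m :: nat and xs :: "nat \<Rightarrow> real"
    and q :: "nat \<Rightarrow> real \<Rightarrow> real \<Rightarrow> real" and f :: "real \<Rightarrow> real \<Rightarrow> real"
  assumes \<alpha>: "0 < \<alpha>" "\<alpha> < 1" and \<mu>: "0 < \<mu>"
    and xs: "\<And>k. k \<in> {1..m} \<Longrightarrow> xs k \<in> {0..l}"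
    and q: "\<And>k x t. k \<in> {1..m} \<Longrightarrow> x \<in> {0<..<l} \<Longrightarrow> t \<in> {0<..T} \<Longrightarrow> \<bar>q k x t\<bar> < c1"
    and f: "square_integrable_on_rectangle l T f"
    and pde: "\<And>x t. x \<in> {0<..<l} \<Longrightarrow> t \<in> {0<..T} \<Longrightarrow>
        caputo_deriv \<alpha> (u x) t =
          partial_x l (partial_x l u) x t
          + \<mu> * partial_t T (partial_x l (partial_x l u)) x t
          + (\<Sum>k=1..m. q k x t * u (xs k) t) + f x t"
begin

abbreviation "\<Gamma>\<^sub>\<alpha> \<equiv> Gamma (1 - \<alpha>)"

lemma Gamma_pos: "0 < \<Gamma>\<^sub>\<alpha>"
  using \<alpha> by (intro Gamma_real_pos) auto

definition reg_caputo :: "real \<Rightarrow> real \<Rightarrow> real \<Rightarrow> real" where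
  "reg_caputo \<epsilon> x \<tau> =
     memory_kernel.regularized_deriv (reg_kernel \<alpha> \<epsilon>) (reg_kernel' \<alpha> \<epsilon>) T (u x) \<tau>"

definition caputo :: "real \<Rightarrow> real \<Rightarrow> real" where
  "caputo x \<tau> = caputo_deriv \<alpha> (u x) \<tau>"

text \<open>On [a, T] the time derivative is bounded uniformly in x by compactness, hence the error
  bound depends on \<epsilon> and a alone; for fixed a both of its terms tend to 0.\<close>

lemma caputo_error:
  assumes a: "0 < a"
  obtains \<rho> where "(\<rho> \<longlongrightarrow> 0) (at_right 0)"
    and "\<And>\<epsilon> x \<tau>. 0 < \<epsilon> \<Longrightarrow> x \<in> {0..l} \<Longrightarrow> \<tau> \<in> {2 * a..T} \<Longrightarrow>
      \<bar>\<Gamma>\<^sub>\<alpha> * caputo x \<tau> - reg_caputo \<epsilon> x \<tau>\<bar> \<le> \<rho> \<epsilon>"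
proof -
  obtain W where W: "\<And>x t. x \<in> {0..l} \<Longrightarrow> t \<in> {0..T} \<Longrightarrow> \<bar>u x t\<bar> \<le> W"
    using bounded_u by blast
  have "bounded ((\<lambda>(x, t). ut x t) ` ({0..l} \<times> {a..T}))"
    by (intro compact_imp_bounded compact_continuous_image compact_Times compact_Icc
        continuous_on_subset[OF cont_ut]) (use a in auto)
  then obtain K where K: "\<And>x t. x \<in> {0..l} \<Longrightarrow> t \<in> {a..T} \<Longrightarrow> \<bar>ut x t\<bar> \<le> K"
    unfolding bounded_iff by fastforce
  define \<rho> where "\<rho> \<epsilon> = 2 * W * kernel_defect \<alpha> \<epsilon> a + K * (\<epsilon> powr (1 - \<alpha>) / (1 - \<alpha>))" for \<epsilon>
  have P: "((\<lambda>\<epsilon>. \<epsilon> powr (1 - \<alpha>)) \<longlongrightarrow> 0) (at_right 0)"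
    using tendsto_powr_at_right_0[of "1 - \<alpha>"] \<alpha> by simp
  have "(\<rho> \<longlongrightarrow> 2 * W * (a powr (- \<alpha>) - a powr (- \<alpha>)) + K * (0 / (1 - \<alpha>))) (at_right 0)"
    unfolding \<rho>_def[abs_def] kernel_defect_def using a \<alpha>
    by (intro tendsto_add tendsto_mult tendsto_diff tendsto_divide tendsto_const tendsto_reg_kernel P) auto
  then have "(\<rho> \<longlongrightarrow> 0) (at_right 0)" by simp
  moreover have "\<bar>\<Gamma>\<^sub>\<alpha> * caputo x \<tau> - reg_caputo \<epsilon> x \<tau>\<bar> \<le> \<rho> \<epsilon>"
    if \<epsilon>: "0 < \<epsilon>" and x: "x \<in> {0..l}" and \<tau>: "\<tau> \<in> {2 * a..T}" for \<epsilon> x \<tau>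
    unfolding caputo_def reg_caputo_def \<rho>_def
  proof (rule caputo_deriv_approx[OF \<alpha> \<epsilon> a, where w' = "ut x"])
    show "continuous_on {0..T} (u x)"
      using x by (intro cont_u_comp continuous_intros) auto
    show "continuous_on {a..T} (ut x)"
      using x a by (intro cont_ut_comp continuous_intros) auto
    fix s assume "s \<in> {0<..<T}"
    then show "(u x has_real_derivative ut x s) (at s)"
      using deriv_ut[OF x, of s] by (simp add: at_within_Icc_at)
  qed (use x \<tau> W K in auto)
  ultimately show ?thesis by (rule that)
qed

lemma continuous_on_reg_caputo:
  assumes "0 < \<epsilon>" "\<tau> \<in> {0..T}"
  shows "continuous_on {0..l} (\<lambda>x. reg_caputo \<epsilon> x \<tau>)"
proof -
  interpret memory_kernel "reg_kernel \<alpha> \<epsilon>" "reg_kernel' \<alpha> \<epsilon>"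
    using assms \<alpha> by (intro memory_kernel_reg)
  show ?thesis
    unfolding reg_caputo_def by (rule continuous_on_regularized_deriv_param[OF cont_u assms(2)])
qed

text \<open>Near t = 0 there is no majorant for u_t uniform in x, so dominated convergence is not at
  hand. Continuity is inherited instead from the regularized derivatives, which converge uniformly
  in x.\<close>

lemma continuous_on_caputo:
  assumes \<tau>: "\<tau> \<in> {0<..T}"
  shows "continuous_on {0..l} (\<lambda>x. caputo x \<tau>)"
proof -
  \<comment> \<open>The choice a = \<tau>/2 is the largest for which \<tau> still belongs to
    [2a, T].\<close>
  obtain \<rho> where \<rho>: "(\<rho> \<longlongrightarrow> 0) (at_right 0)"
    and err: "\<And>\<epsilon> x \<tau>'. 0 < \<epsilon> \<Longrightarrow> x \<in> {0..l} \<Longrightarrow> \<tau>' \<in> {2 * (\<tau> / 2)..T} \<Longrightarrow>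
      \<bar>\<Gamma>\<^sub>\<alpha> * caputo x \<tau>' - reg_caputo \<epsilon> x \<tau>'\<bar> \<le> \<rho> \<epsilon>"
    using caputo_error[of "\<tau> / 2"] \<tau> by auto
  have ev: "eventually (\<lambda>\<epsilon>::real. 0 < \<epsilon>) (at_right 0)"
    by (simp add: eventually_at_right_less)
  have "uniform_limit {0..l} (\<lambda>\<epsilon> x. reg_caputo \<epsilon> x \<tau>) (\<lambda>x. \<Gamma>\<^sub>\<alpha> * caputo x \<tau>) (at_right 0)"
  proof (rule uniform_limitI)
    fix e :: real assume "0 < e"
    then have "eventually (\<lambda>\<epsilon>. \<rho> \<epsilon> < e) (at_right 0)"
      using \<rho> by (intro order_tendstoD) auto
    with ev show "\<forall>\<^sub>F \<epsilon> in at_right 0. \<forall>x\<in>{0..l}. dist (reg_caputo \<epsilon> x \<tau>) (\<Gamma>\<^sub>\<alpha> * caputo x \<tau>) < e"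
    proof eventually_elim
      case (elim \<epsilon>)
      then show ?case
        using err[of \<epsilon> _ \<tau>] \<tau> by (force simp: dist_real_def abs_minus_commute)
    qed
  qed
  then have C: "continuous_on {0..l} (\<lambda>x. \<Gamma>\<^sub>\<alpha> * caputo x \<tau>)"
  proof (rule uniform_limit_theorem[rotated])
    show "\<forall>\<^sub>F \<epsilon> in at_right 0. continuous_on {0..l} (\<lambda>x. reg_caputo \<epsilon> x \<tau>)"
      using ev by eventually_elim (use \<tau> in \<open>auto intro: continuous_on_reg_caputo\<close>)
  qed simp
  have "continuous_on {0..l} (\<lambda>x. \<Gamma>\<^sub>\<alpha> * caputo x \<tau> / \<Gamma>\<^sub>\<alpha>)"
    by (rule continuous_on_divide[OF C continuous_on_const])
      (use less_imp_neq[OF Gamma_pos] in simp)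
  then show ?thesis
    by (simp only: nonzero_mult_div_cancel_left[OF less_imp_neq[OF Gamma_pos, symmetric]])
qed

text \<open>The right-hand side of the equation without its second derivatives. On the open interval it
  is the source \<open>\<Sum>q\<^sub>k u(x\<^sub>k, \<tau>) + f\<close>; written this way it is visibly continuous in \<open>x\<close> up to
  the boundary, whereas \<open>q\<^sub>k\<close> and \<open>f\<close> separately need not be.\<close>

definition source :: "real \<Rightarrow> real \<Rightarrow> real" where
  "source x \<tau> = caputo x \<tau> - uxx x \<tau> - \<mu> * uxxt x \<tau>"

lemma continuous_on_source:
  assumes "\<tau> \<in> {0<..T}"
  shows "continuous_on {0..l} (\<lambda>x. source x \<tau>)"
  unfolding source_def using assms
  by (intro continuous_intros continuous_on_caputo cont_uxx_comp cont_uxxt_comp) auto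

lemma source_eq:
  assumes "x \<in> {0<..<l}" "\<tau> \<in> {0<..T}"
  shows "source x \<tau> = (\<Sum>k=1..m. q k x \<tau> * u (xs k) \<tau>) + f x \<tau>"
  using pde[OF assms] by (simp add: source_def caputo_def)

lemma abs_le_sqrt_energy:
  assumes "x \<in> {0..l}" "t \<in> {0..T}"
  shows "\<bar>u x t\<bar> \<le> sqrt (l * energy t)"
  using real_sqrt_le_mono[OF square_le_energy[OF assms]] by simp

lemma loaded_sum_bound:
  assumes x: "x \<in> {0<..<l}" and t: "\<tau> \<in> {0<..T}"
  shows "\<bar>\<Sum>k=1..m. q k x \<tau> * u (xs k) \<tau>\<bar> \<le> real m * \<bar>c1\<bar> * sqrt (l * energy \<tau>)"
proof -
  have "\<bar>\<Sum>k=1..m. q k x \<tau> * u (xs k) \<tau>\<bar> \<le> (\<Sum>k=1..m. \<bar>c1\<bar> * sqrt (l * energy \<tau>))"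
  proof (rule order_trans[OF sum_abs sum_mono])
    fix k assume k: "k \<in> {1..m}"
    have "\<bar>q k x \<tau>\<bar> \<le> \<bar>c1\<bar>" using q[OF k x t] by linarith
    then show "\<bar>q k x \<tau> * u (xs k) \<tau>\<bar> \<le> \<bar>c1\<bar> * sqrt (l * energy \<tau>)"
      unfolding abs_mult using xs[OF k] t by (intro mult_mono abs_le_sqrt_energy) auto
  qed
  then show ?thesis by simp
qed

text \<open>The energy coefficient of the source term: m |c1| l comes from the loaded terms and l/2
  from Young's inequality for u f, both through u^2 \<le> l energy; the outer factor l is the length
  of the interval.\<close>

definition rate :: real where
  "rate = l * (real m * \<bar>c1\<bar> * l + l / 2)"

lemma rate_pos: "0 < rate"
  using l_pos by (auto simp: rate_def intro!: mult_pos_pos add_nonneg_pos)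

text \<open>On the open interval f is the continuous \<open>source\<close> minus the loaded sum, and
  both are bounded at a fixed time.\<close>

lemma section_integrable:
  assumes t: "\<tau> \<in> {0<..<T}"
  shows "set_integrable lborel {0<..<l} (\<lambda>x. (f x \<tau>)\<^sup>2)"
proof -
  have t': "\<tau> \<in> {0<..T}" using t by auto
  have "bounded ((\<lambda>x. source x \<tau>) ` {0..l})"
    by (intro compact_imp_bounded compact_continuous_image compact_Icc continuous_on_source t')
  then obtain B where B: "\<And>x. x \<in> {0..l} \<Longrightarrow> \<bar>source x \<tau>\<bar> \<le> B"
    unfolding bounded_iff by fastforce
  have "\<bar>f x \<tau>\<bar> \<le> B + real m * \<bar>c1\<bar> * sqrt (l * energy \<tau>)" if x: "x \<in> {0<..<l}" for x
    using B[of x] loaded_sum_bound[OF x t'] source_eq[OF x t'] x by auto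
  then show ?thesis
    by (rule square_integrable_section[OF f t])
qed

lemma integral_source_le:
  assumes t: "\<tau> \<in> {0<..<T}"
  shows "integral {0..l} (\<lambda>x. u x \<tau> * source x \<tau>) \<le> rate * energy \<tau> + norm0_sq l (\<lambda>x. f x \<tau>) / 2"
proof -
  have t': "\<tau> \<in> {0<..T}" "\<tau> \<in> {0..T}" using t by auto
  define D where "D = (real m * \<bar>c1\<bar> * l + l / 2) * energy \<tau>"
  have "((\<lambda>x. (f x \<tau>)\<^sup>2) has_integral norm0_sq l (\<lambda>x. f x \<tau>)) {0..l}"
    unfolding norm0_sq_def by (intro integrable_integral norm0_sq_section(1) section_integrable t)
  moreover have "((\<lambda>x. D) has_integral l * D) {0..l}"
    using has_integral_const_real[of D 0 l] l_pos by simp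
  ultimately have A: "((\<lambda>x. D + (f x \<tau>)\<^sup>2 / 2) has_integral l * D + norm0_sq l (\<lambda>x. f x \<tau>) / 2) (box 0 l)"
    unfolding has_integral_open_interval cbox_interval
    by (intro has_integral_add has_integral_divide)
  have S: "((\<lambda>x. u x \<tau> * source x \<tau>) has_integral integral {0..l} (\<lambda>x. u x \<tau> * source x \<tau>)) (box 0 l)"
    unfolding has_integral_open_interval cbox_interval using t'
    by (intro integrable_integral integrable_continuous_real continuous_intros cont_u_comp continuous_on_source) auto
  have le: "u x \<tau> * source x \<tau> \<le> D + (f x \<tau>)\<^sup>2 / 2" if "x \<in> box 0 l" for x
  proof -
    let ?S = "\<Sum>k=1..m. q k x \<tau> * u (xs k) \<tau>" and ?e = "sqrt (l * energy \<tau>)"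
    have x: "x \<in> {0<..<l}" "x \<in> {0..l}" using that by auto
    have e: "0 \<le> l * energy \<tau>" using l_pos energy_nonneg by simp
    have "u x \<tau> * ?S \<le> \<bar>u x \<tau>\<bar> * \<bar>?S\<bar>"
      using abs_ge_self[of "u x \<tau> * ?S"] by (simp only: abs_mult)
    also have "\<dots> \<le> ?e * (real m * \<bar>c1\<bar> * ?e)"
      using e by (intro mult_mono abs_le_sqrt_energy loaded_sum_bound x t') auto
    also have "\<dots> = real m * \<bar>c1\<bar> * (?e * ?e)" by simp
    also have "?e * ?e = l * energy \<tau>" using e by simp
    finally have 1: "u x \<tau> * ?S \<le> real m * \<bar>c1\<bar> * (l * energy \<tau>)" .
    have "0 \<le> (u x \<tau> - f x \<tau>)\<^sup>2" by simp
    then have 2: "u x \<tau> * f x \<tau> \<le> (u x \<tau>)\<^sup>2 / 2 + (f x \<tau>)\<^sup>2 / 2"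
      by (simp add: power2_eq_square algebra_simps)
    show ?thesis
      using 1 2 square_le_energy[OF x(2) t'(2)]
      by (simp add: source_eq[OF x(1) t'(1)] D_def algebra_simps)
  qed
  have "integral {0..l} (\<lambda>x. u x \<tau> * source x \<tau>) \<le> l * D + norm0_sq l (\<lambda>x. f x \<tau>) / 2"
    by (rule has_integral_le[OF S A le])
  then show ?thesis by (simp add: D_def rate_def mult.assoc)
qed

definition source_mass :: "real \<Rightarrow> real" where
  "source_mass \<tau> = norm0_sq l (\<lambda>x. f x \<tau>)"

lemma source_mass_integrable: "t \<in> {0..T} \<Longrightarrow> source_mass integrable_on {0..t}"
  using norm0_sq_integrable_in_time[OF f section_integrable]
  by (auto simp: source_mass_def[abs_def] intro: integrable_on_subinterval)

lemma source_mass_nonneg: "0 \<le> source_mass \<tau>"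
  by (simp add: source_mass_def norm0_sq_nonneg)

text \<open>Replacing the Caputo derivative by its regularization costs at most W r pointwise, hence
  l W r after integration; the integrated Alikhanov inequality does the rest.\<close>

lemma integral_caputo_ge:
  assumes \<epsilon>: "0 < \<epsilon>" and \<tau>: "\<tau> \<in> {0<..T}"
    and err: "\<And>x. x \<in> {0..l} \<Longrightarrow> \<bar>\<Gamma>\<^sub>\<alpha> * caputo x \<tau> - reg_caputo \<epsilon> x \<tau>\<bar> \<le> r"
    and W: "\<And>x. x \<in> {0..l} \<Longrightarrow> \<bar>u x \<tau>\<bar> \<le> W"
  shows "memory_kernel.regularized_deriv (reg_kernel \<alpha> \<epsilon>) (reg_kernel' \<alpha> \<epsilon>) T mass \<tau> / 2 - l * (W * r)
    \<le> \<Gamma>\<^sub>\<alpha> * integral {0..l} (\<lambda>x. u x \<tau> * caputo x \<tau>)"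
proof -
  interpret memory_kernel "reg_kernel \<alpha> \<epsilon>" "reg_kernel' \<alpha> \<epsilon>"
    using \<epsilon> \<alpha> by (intro memory_kernel_reg)
  have \<tau>': "\<tau> \<in> {0..T}" using \<tau> by auto
  have u: "continuous_on {0..l} (\<lambda>x. u x \<tau>)"
    using \<tau>' by (intro cont_u_comp continuous_intros) auto
  define R where "R = integral {0..l} (\<lambda>x. u x \<tau> * reg_caputo \<epsilon> x \<tau>)"
  define C where "C = integral {0..l} (\<lambda>x. u x \<tau> * caputo x \<tau>)"
  have "regularized_deriv T mass \<tau> / 2 \<le> R"
    using integral_regularized_deriv_product_ge[OF cont_u \<tau>']
    by (simp add: R_def reg_caputo_def mass_def[abs_def])
  moreover have "R - l * (W * r) \<le> \<Gamma>\<^sub>\<alpha> * C"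
  proof (rule has_integral_le)
    have "((\<lambda>x. u x \<tau> * reg_caputo \<epsilon> x \<tau>) has_integral R) {0..l}"
      unfolding R_def
      by (intro integrable_integral integrable_continuous_real continuous_on_mult u continuous_on_reg_caputo \<epsilon> \<tau>')
    moreover have "((\<lambda>x. W * r) has_integral l * (W * r)) {0..l}"
      using has_integral_const_real[of "W * r" 0 l] l_pos by simp
    ultimately show "((\<lambda>x. u x \<tau> * reg_caputo \<epsilon> x \<tau> - W * r) has_integral R - l * (W * r)) {0..l}"
      by (rule has_integral_diff)
    have "((\<lambda>x. u x \<tau> * caputo x \<tau>) has_integral C) {0..l}"
      unfolding C_def
      by (intro integrable_integral integrable_continuous_real continuous_on_mult u continuous_on_caputo \<tau>)
    then show "((\<lambda>x. \<Gamma>\<^sub>\<alpha> * (u x \<tau> * caputo x \<tau>)) has_integral \<Gamma>\<^sub>\<alpha> * C) {0..l}"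
      by (rule has_integral_mult_right)
    fix x assume x: "x \<in> {0..l}"
    have "\<bar>u x \<tau>\<bar> * \<bar>\<Gamma>\<^sub>\<alpha> * caputo x \<tau> - reg_caputo \<epsilon> x \<tau>\<bar> \<le> W * r"
      by (rule mult_mono[OF W[OF x] err[OF x]]) (use W[OF x] in auto)
    then have "- (W * r) \<le> u x \<tau> * (\<Gamma>\<^sub>\<alpha> * caputo x \<tau> - reg_caputo \<epsilon> x \<tau>)"
      unfolding abs_mult[symmetric] by linarith
    then show "u x \<tau> * reg_caputo \<epsilon> x \<tau> - W * r \<le> \<Gamma>\<^sub>\<alpha> * (u x \<tau> * caputo x \<tau>)"
      by (simp add: algebra_simps)
  qed
  ultimately show ?thesis by (simp add: C_def)
qed

text \<open>The equation tested with u and solved for the term that is, up to the factor -\<mu>/2,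
  the time derivative of the energy.\<close>

lemma integral_u_uxxt:
  assumes \<tau>: "\<tau> \<in> {0<..T}"
  shows "\<mu> * integral {0..l} (\<lambda>x. u x \<tau> * uxxt x \<tau>) =
    integral {0..l} (\<lambda>x. u x \<tau> * caputo x \<tau>) + energy \<tau> - integral {0..l} (\<lambda>x. u x \<tau> * source x \<tau>)"
proof -
  have u: "continuous_on {0..l} (\<lambda>x. u x \<tau>)" and uxx: "continuous_on {0..l} (\<lambda>x. uxx x \<tau>)"
    and uxxt: "continuous_on {0..l} (\<lambda>x. uxxt x \<tau>)"
    using \<tau> by (intro cont_u_comp cont_uxx_comp cont_uxxt_comp continuous_intros; auto)+
  have "((\<lambda>x. u x \<tau> * caputo x \<tau> - u x \<tau> * uxx x \<tau> - \<mu> * (u x \<tau> * uxxt x \<tau>)) has_integral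
      integral {0..l} (\<lambda>x. u x \<tau> * caputo x \<tau>) - integral {0..l} (\<lambda>x. u x \<tau> * uxx x \<tau>)
      - \<mu> * integral {0..l} (\<lambda>x. u x \<tau> * uxxt x \<tau>)) {0..l}"
    by (intro has_integral_diff has_integral_mult_right integrable_integral integrable_continuous_real
        continuous_on_mult u uxx uxxt continuous_on_caputo \<tau>)
  then have "((\<lambda>x. u x \<tau> * source x \<tau>) has_integral
      integral {0..l} (\<lambda>x. u x \<tau> * caputo x \<tau>) - integral {0..l} (\<lambda>x. u x \<tau> * uxx x \<tau>)
      - \<mu> * integral {0..l} (\<lambda>x. u x \<tau> * uxxt x \<tau>)) {0..l}"
    by (simp add: source_def algebra_simps)
  then show ?thesis
    using energy_eq[OF \<tau>] by (simp add: integral_unique)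
qed

text \<open>Needed, uniformly in \<epsilon>, for the term \<open>k t * G 0\<close> in the derivative
  of the memory, where the initial mass appears.\<close>

lemma integral_reg_kernel_le:
  assumes \<epsilon>: "0 < \<epsilon>" and a: "0 < a" "a \<le> t" "t \<le> T"
  shows "reg_kernel \<alpha> \<epsilon> integrable_on {a..t}"
    and "integral {a..t} (reg_kernel \<alpha> \<epsilon>) \<le> T powr (1 - \<alpha>) / (1 - \<alpha>)"
proof -
  interpret memory_kernel "reg_kernel \<alpha> \<epsilon>" "reg_kernel' \<alpha> \<epsilon>"
    using \<epsilon> \<alpha> by (intro memory_kernel_reg)
  show i: "reg_kernel \<alpha> \<epsilon> integrable_on {a..t}"
    by (rule integrable_continuous_real, rule continuous_on_subset[OF cont_k]) simp
  have J: "((\<lambda>\<tau>. \<tau> powr (- \<alpha>)) has_integral t powr (1 - \<alpha>) / (1 - \<alpha>) - a powr (1 - \<alpha>) / (1 - \<alpha>)) {a..t}"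
  proof (rule fundamental_theorem_of_calculus[OF a(2)])
    fix x assume "x \<in> {a..t}"
    then have "((\<lambda>\<tau>. \<tau> powr (1 - \<alpha>)) has_real_derivative (1 - \<alpha>) * x powr (1 - \<alpha> - 1)) (at x)"
      using a by (intro has_real_derivative_powr) auto
    from DERIV_cdivide[OF this, of "1 - \<alpha>"]
    have "((\<lambda>\<tau>. \<tau> powr (1 - \<alpha>) / (1 - \<alpha>)) has_real_derivative x powr (- \<alpha>)) (at x)"
      using \<alpha> by simp
    then show "((\<lambda>\<tau>. \<tau> powr (1 - \<alpha>) / (1 - \<alpha>)) has_vector_derivative x powr (- \<alpha>)) (at x within {a..t})"
      by (simp add: has_real_derivative_iff_has_vector_derivative has_vector_derivative_at_within)
  qed
  have "integral {a..t} (reg_kernel \<alpha> \<epsilon>) \<le> t powr (1 - \<alpha>) / (1 - \<alpha>) - a powr (1 - \<alpha>) / (1 - \<alpha>)"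
    by (rule has_integral_le[OF integrable_integral[OF i] J]) (use \<alpha> a in \<open>auto intro: reg_kernel_le\<close>)
  also have "\<dots> \<le> T powr (1 - \<alpha>) / (1 - \<alpha>)"
  proof -
    have "t powr (1 - \<alpha>) / (1 - \<alpha>) \<le> T powr (1 - \<alpha>) / (1 - \<alpha>)"
      using \<alpha> a by (intro divide_right_mono powr_mono2) auto
    moreover have "0 \<le> a powr (1 - \<alpha>) / (1 - \<alpha>)" using \<alpha> by simp
    ultimately show ?thesis by linarith
  qed
  finally show "integral {a..t} (reg_kernel \<alpha> \<epsilon>) \<le> T powr (1 - \<alpha>) / (1 - \<alpha>)" .
qed

text \<open>The differential energy inequality integrated over [2a, t]. The last bracket collects
  all errors due to the regularization; the terms in 2a come from the lower limit.\<close>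

lemma energy_inequality_reg:
  assumes \<epsilon>: "0 < \<epsilon>" and a: "0 < a" "2 * a \<le> t" "t \<le> T"
    and err: "\<And>x \<tau>. x \<in> {0..l} \<Longrightarrow> \<tau> \<in> {2 * a..T} \<Longrightarrow>
      \<bar>\<Gamma>\<^sub>\<alpha> * caputo x \<tau> - reg_caputo \<epsilon> x \<tau>\<bar> \<le> r"
    and B: "\<And>s. s \<in> {0..T} \<Longrightarrow> mass s \<le> B"
    and W: "\<And>x t. x \<in> {0..l} \<Longrightarrow> t \<in> {0..T} \<Longrightarrow> \<bar>u x t\<bar> \<le> W"
  shows "RL_integral \<alpha> mass t / 2 + \<mu> / 2 * energy t \<le>
    \<mu> / 2 * energy (2 * a) + B * ((2 * a) powr (1 - \<alpha>) / (1 - \<alpha>)) / (2 * \<Gamma>\<^sub>\<alpha>)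
    + mass 0 * (T powr (1 - \<alpha>) / (1 - \<alpha>)) / (2 * \<Gamma>\<^sub>\<alpha>)
    + rate * integral {0..t} energy + integral {0..t} source_mass / 2
    + (B * (\<epsilon> powr (1 - \<alpha>) / (1 - \<alpha>)) / (2 * \<Gamma>\<^sub>\<alpha>) + T * (l * (W * r) / \<Gamma>\<^sub>\<alpha>))"
proof -
  interpret memory_kernel "reg_kernel \<alpha> \<epsilon>" "reg_kernel' \<alpha> \<epsilon>"
    using \<epsilon> \<alpha> by (intro memory_kernel_reg)
  let ?k = "reg_kernel \<alpha> \<epsilon>"
  have t: "0 \<le> t" "t \<in> {0..T}" "0 < 2 * a" "0 \<le> 2 * a" using a by auto
  have G: "0 < \<Gamma>\<^sub>\<alpha>" by (rule Gamma_pos)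
  define \<Phi> where "\<Phi> \<tau> = memory mass \<tau> / (2 * \<Gamma>\<^sub>\<alpha>) + \<mu> / 2 * energy \<tau>" for \<tau>
  define \<Phi>' where "\<Phi>' \<tau> = (regularized_deriv T mass \<tau> + ?k \<tau> * mass 0) / (2 * \<Gamma>\<^sub>\<alpha>)
      - \<mu> * integral {0..l} (\<lambda>x. u x \<tau> * uxxt x \<tau>)" for \<tau>
  define c where "c = l * (W * r) / \<Gamma>\<^sub>\<alpha>"
  have "(\<Phi> has_vector_derivative \<Phi>' \<tau>) (at \<tau> within {2 * a..t})" if \<tau>: "\<tau> \<in> {2 * a..t}" for \<tau>
  proof -
    have "(memory mass has_real_derivative regularized_deriv T mass \<tau> + ?k \<tau> * mass 0) (at \<tau> within {2 * a..t})"
      unfolding has_real_derivative_iff_has_vector_derivative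
      by (rule has_vector_derivative_within_subset[OF memory_has_derivative[OF continuous_on_mass]])
        (use \<tau> a in auto)
    moreover have "(energy has_real_derivative - 2 * integral {0..l} (\<lambda>x. u x \<tau> * uxxt x \<tau>)) (at \<tau> within {2 * a..t})"
      by (rule DERIV_subset[OF energy_has_derivative]) (use \<tau> a in auto)
    ultimately have "(\<Phi> has_real_derivative (regularized_deriv T mass \<tau> + ?k \<tau> * mass 0) / (2 * \<Gamma>\<^sub>\<alpha>)
        + \<mu> / 2 * (- 2 * integral {0..l} (\<lambda>x. u x \<tau> * uxxt x \<tau>))) (at \<tau> within {2 * a..t})"
      unfolding \<Phi>_def[abs_def] by (intro DERIV_add DERIV_cmult DERIV_cdivide)
    then show ?thesis
      by (simp add: \<Phi>'_def has_real_derivative_iff_has_vector_derivative)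
  qed
  \<comment> \<open>The open interval matters: t = T is allowed, but the source estimate is
    available only at times before T.\<close>
  then have lhs: "(\<Phi>' has_integral \<Phi> t - \<Phi> (2 * a)) (box (2 * a) t)"
    unfolding has_integral_open_interval cbox_interval
    by (rule fundamental_theorem_of_calculus[OF a(2)])
  have iE: "energy integrable_on {0..t}"
    by (rule integrable_continuous_real, rule continuous_on_subset[OF continuous_on_energy]) (use a in auto)
  have iE': "energy integrable_on {2 * a..t}" and iS: "source_mass integrable_on {2 * a..t}"
    using iE source_mass_integrable[OF t(2)] t by (auto intro: integrable_on_subinterval)
  have iK: "?k integrable_on {2 * a..t}"
    by (rule integral_reg_kernel_le(1)[OF \<epsilon> t(3) a(2,3)])
  have "((\<lambda>\<tau>. c) has_integral (t - 2 * a) * c) {2 * a..t}"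
    using has_integral_const_real[of c "2 * a" t] a by simp
  then have rhs: "((\<lambda>\<tau>. mass 0 / (2 * \<Gamma>\<^sub>\<alpha>) * ?k \<tau> + rate * energy \<tau> + source_mass \<tau> / 2 + c) has_integral
      mass 0 / (2 * \<Gamma>\<^sub>\<alpha>) * integral {2 * a..t} ?k + rate * integral {2 * a..t} energy
      + integral {2 * a..t} source_mass / 2 + (t - 2 * a) * c) (box (2 * a) t)"
    unfolding has_integral_open_interval cbox_interval
    by (intro has_integral_add has_integral_mult_right has_integral_divide integrable_integral iE' iS iK)
  have le: "\<Phi>' \<tau> \<le> mass 0 / (2 * \<Gamma>\<^sub>\<alpha>) * ?k \<tau> + rate * energy \<tau> + source_mass \<tau> / 2 + c"
    if "\<tau> \<in> box (2 * a) t" for \<tau>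
  proof -
    have \<tau>: "\<tau> \<in> {0<..T}" "\<tau> \<in> {0<..<T}" "\<tau> \<in> {2 * a..T}" using that a by auto
    define C where "C = integral {0..l} (\<lambda>x. u x \<tau> * caputo x \<tau>)"
    have "regularized_deriv T mass \<tau> / 2 - l * (W * r) \<le> \<Gamma>\<^sub>\<alpha> * C"
      unfolding C_def by (rule integral_caputo_ge[OF \<epsilon> \<tau>(1) err[OF _ \<tau>(3)] W]) (use \<tau> in auto)
    then have "(regularized_deriv T mass \<tau> / 2 - l * (W * r)) / \<Gamma>\<^sub>\<alpha> \<le> C"
      using G by (simp add: pos_divide_le_eq mult.commute)
    then have "regularized_deriv T mass \<tau> / (2 * \<Gamma>\<^sub>\<alpha>) - c \<le> C"
      by (simp add: c_def diff_divide_distrib)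
    moreover have "\<mu> * integral {0..l} (\<lambda>x. u x \<tau> * uxxt x \<tau>) \<ge>
        C + energy \<tau> - (rate * energy \<tau> + source_mass \<tau> / 2)"
      unfolding integral_u_uxxt[OF \<tau>(1)] C_def source_mass_def
      using integral_source_le[OF \<tau>(2)] by linarith
    moreover have "(regularized_deriv T mass \<tau> + ?k \<tau> * mass 0) / (2 * \<Gamma>\<^sub>\<alpha>) =
        regularized_deriv T mass \<tau> / (2 * \<Gamma>\<^sub>\<alpha>) + mass 0 / (2 * \<Gamma>\<^sub>\<alpha>) * ?k \<tau>"
      by (simp add: add_divide_distrib mult.commute)
    \<comment> \<open>The dissipation term \<open>energy \<tau>\<close> produced by u_xx has a
      favourable sign and is discarded.\<close>
    ultimately show ?thesis
      unfolding \<Phi>'_def using energy_nonneg[of \<tau>] by linarith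
  qed
  have main: "\<Phi> t - \<Phi> (2 * a) \<le> mass 0 / (2 * \<Gamma>\<^sub>\<alpha>) * integral {2 * a..t} ?k + rate * integral {2 * a..t} energy
      + integral {2 * a..t} source_mass / 2 + (t - 2 * a) * c"
    by (rule has_integral_le[OF lhs rhs le])

  have cm: "continuous_on {0..s} mass" and Bm: "\<And>s'. s' \<in> {0..s} \<Longrightarrow> \<bar>mass s'\<bar> \<le> B" if "s \<le> T" for s
    using that B mass_nonneg by (auto intro: continuous_on_subset[OF continuous_on_mass])
  \<comment> \<open>At the upper limit the memory is exchanged for the Riemann--Liouville integral;
    at the lower limit it is merely bounded.\<close>
  have "\<bar>\<Gamma>\<^sub>\<alpha> * RL_integral \<alpha> mass t - memory mass t\<bar> \<le> B * (\<epsilon> powr (1 - \<alpha>) / (1 - \<alpha>))"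
    by (rule memory_reg_approx[OF \<alpha> \<epsilon> t(1) cm[OF a(3)] Bm[OF a(3)]])
  then have "(\<Gamma>\<^sub>\<alpha> * RL_integral \<alpha> mass t - B * (\<epsilon> powr (1 - \<alpha>) / (1 - \<alpha>))) / (2 * \<Gamma>\<^sub>\<alpha>) \<le> memory mass t / (2 * \<Gamma>\<^sub>\<alpha>)"
    using G by (intro divide_right_mono) auto
  moreover have "(\<Gamma>\<^sub>\<alpha> * RL_integral \<alpha> mass t - B * (\<epsilon> powr (1 - \<alpha>) / (1 - \<alpha>))) / (2 * \<Gamma>\<^sub>\<alpha>) =
      RL_integral \<alpha> mass t / 2 - B * (\<epsilon> powr (1 - \<alpha>) / (1 - \<alpha>)) / (2 * \<Gamma>\<^sub>\<alpha>)"
    using less_imp_neq[OF G] by (simp add: diff_divide_distrib)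
  ultimately have 1: "RL_integral \<alpha> mass t / 2 - B * (\<epsilon> powr (1 - \<alpha>) / (1 - \<alpha>)) / (2 * \<Gamma>\<^sub>\<alpha>) \<le> memory mass t / (2 * \<Gamma>\<^sub>\<alpha>)"
    by linarith
  have "\<bar>memory mass (2 * a)\<bar> \<le> B * ((2 * a) powr (1 - \<alpha>) / (1 - \<alpha>))"
    by (rule memory_reg_bound[OF \<alpha> \<epsilon> t(4) cm Bm]) (use a in auto)
  then have 2: "memory mass (2 * a) / (2 * \<Gamma>\<^sub>\<alpha>) \<le> B * ((2 * a) powr (1 - \<alpha>) / (1 - \<alpha>)) / (2 * \<Gamma>\<^sub>\<alpha>)"
    using G by (intro divide_right_mono) auto
  have "mass 0 / (2 * \<Gamma>\<^sub>\<alpha>) * integral {2 * a..t} ?k \<le> mass 0 / (2 * \<Gamma>\<^sub>\<alpha>) * (T powr (1 - \<alpha>) / (1 - \<alpha>))"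
    using G mass_nonneg[of 0]
    by (intro mult_left_mono integral_reg_kernel_le(2)[OF \<epsilon> t(3) a(2,3)]) auto
  then have 3: "mass 0 / (2 * \<Gamma>\<^sub>\<alpha>) * integral {2 * a..t} ?k \<le> mass 0 * (T powr (1 - \<alpha>) / (1 - \<alpha>)) / (2 * \<Gamma>\<^sub>\<alpha>)"
    by (simp only: times_divide_eq_left)
  have "integral {2 * a..t} energy \<le> integral {0..t} energy"
    using t by (intro integral_subset_le iE iE') (auto simp: energy_nonneg)
  then have 4: "rate * integral {2 * a..t} energy \<le> rate * integral {0..t} energy"
    using rate_pos by (intro mult_left_mono) auto
  have 5: "integral {2 * a..t} source_mass \<le> integral {0..t} source_mass"
    using t by (intro integral_subset_le source_mass_integrable iS) (auto simp: source_mass_nonneg)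
  have "0 \<le> W" "0 \<le> r"
    using W[of 0 0] err[of 0 T] l_pos T_pos a by (auto intro: order_trans[OF abs_ge_zero])
  then have "0 \<le> c" using l_pos G by (simp add: c_def)
  then have 6: "(t - 2 * a) * c \<le> T * c"
    using a by (intro mult_right_mono) auto
  show ?thesis
    using main 1 2 3 4 5 6 unfolding \<Phi>_def c_def[symmetric] by linarith
qed

text \<open>The limit \<epsilon> \<rightarrow> 0 with a fixed, which removes the error
  bracket.\<close>

lemma energy_inequality_pos:
  assumes a: "0 < a" "2 * a \<le> t" "t \<le> T"
    and B: "\<And>s. s \<in> {0..T} \<Longrightarrow> mass s \<le> B"
  shows "RL_integral \<alpha> mass t / 2 + \<mu> / 2 * energy t \<le>
    \<mu> / 2 * energy (2 * a) + B * ((2 * a) powr (1 - \<alpha>) / (1 - \<alpha>)) / (2 * \<Gamma>\<^sub>\<alpha>)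
    + mass 0 * (T powr (1 - \<alpha>) / (1 - \<alpha>)) / (2 * \<Gamma>\<^sub>\<alpha>)
    + rate * integral {0..t} energy + integral {0..t} source_mass / 2" (is "?L \<le> ?R")
proof -
  obtain \<rho> where \<rho>: "(\<rho> \<longlongrightarrow> 0) (at_right 0)"
    and err: "\<And>\<epsilon> x \<tau>. 0 < \<epsilon> \<Longrightarrow> x \<in> {0..l} \<Longrightarrow> \<tau> \<in> {2 * a..T} \<Longrightarrow>
      \<bar>\<Gamma>\<^sub>\<alpha> * caputo x \<tau> - reg_caputo \<epsilon> x \<tau>\<bar> \<le> \<rho> \<epsilon>"
    using caputo_error[OF a(1)] by blast
  obtain W where W: "\<And>x t. x \<in> {0..l} \<Longrightarrow> t \<in> {0..T} \<Longrightarrow> \<bar>u x t\<bar> \<le> W"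
    using bounded_u by blast
  have P: "((\<lambda>\<epsilon>. \<epsilon> powr (1 - \<alpha>)) \<longlongrightarrow> 0) (at_right 0)"
    using tendsto_powr_at_right_0[of "1 - \<alpha>"] \<alpha> by simp
  have "((\<lambda>\<epsilon>. ?R + (B * (\<epsilon> powr (1 - \<alpha>) / (1 - \<alpha>)) / (2 * \<Gamma>\<^sub>\<alpha>) + T * (l * (W * \<rho> \<epsilon>) / \<Gamma>\<^sub>\<alpha>))) \<longlongrightarrow>
      ?R + (B * (0 / (1 - \<alpha>)) / (2 * \<Gamma>\<^sub>\<alpha>) + T * (l * (W * 0) / \<Gamma>\<^sub>\<alpha>))) (at_right 0)"
    using \<alpha> less_imp_neq[OF Gamma_pos]
    by (intro tendsto_add tendsto_mult tendsto_divide tendsto_const P \<rho>) auto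
  then have "((\<lambda>\<epsilon>. ?R + (B * (\<epsilon> powr (1 - \<alpha>) / (1 - \<alpha>)) / (2 * \<Gamma>\<^sub>\<alpha>) + T * (l * (W * \<rho> \<epsilon>) / \<Gamma>\<^sub>\<alpha>))) \<longlongrightarrow> ?R) (at_right 0)"
    by simp
  moreover have "eventually (\<lambda>\<epsilon>. ?L \<le> ?R + (B * (\<epsilon> powr (1 - \<alpha>) / (1 - \<alpha>)) / (2 * \<Gamma>\<^sub>\<alpha>) + T * (l * (W * \<rho> \<epsilon>) / \<Gamma>\<^sub>\<alpha>))) (at_right 0)"
    using eventually_at_right_less
  proof eventually_elim
    case (elim \<epsilon>)
    show ?case by (rule energy_inequality_reg[OF elim a err[OF elim] B W])
  qed
  ultimately show ?thesis
    by (rule tendsto_lowerbound) simp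
qed

text \<open>The limit a \<rightarrow> 0: the energy is continuous up to t = 0, and the bound on the
  memory at 2a is a multiple of (2a)^(1-\<alpha>).\<close>

lemma energy_inequality:
  assumes t: "t \<in> {0..T}"
  shows "RL_integral \<alpha> mass t / 2 + \<mu> / 2 * energy t \<le>
    \<mu> / 2 * energy 0 + mass 0 * (T powr (1 - \<alpha>) / (1 - \<alpha>)) / (2 * \<Gamma>\<^sub>\<alpha>)
    + rate * integral {0..t} energy + integral {0..t} source_mass / 2"
proof (cases "t = 0")
  case True
  have "0 \<le> mass 0 * (T powr (1 - \<alpha>) / (1 - \<alpha>)) / (2 * \<Gamma>\<^sub>\<alpha>)"
    using \<alpha> less_imp_le[OF Gamma_pos] mass_nonneg by (intro divide_nonneg_nonneg mult_nonneg_nonneg) auto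
  then show ?thesis
    using True by (simp add: RL_integral_def)
next
  case False
  then have t0: "0 < t" "t \<le> T" using t by auto
  let ?L = "RL_integral \<alpha> mass t / 2 + \<mu> / 2 * energy t"
  let ?C = "mass 0 * (T powr (1 - \<alpha>) / (1 - \<alpha>)) / (2 * \<Gamma>\<^sub>\<alpha>)"
  let ?E = "rate * integral {0..t} energy" and ?S = "integral {0..t} source_mass / 2"
  have "bounded (mass ` {0..T})"
    by (intro compact_imp_bounded compact_continuous_image continuous_on_mass compact_Icc)
  then obtain B where B': "\<forall>s\<in>{0..T}. norm (mass s) \<le> B"
    unfolding bounded_iff by blast
  then have B: "mass s \<le> B" if "s \<in> {0..T}" for s
    using that by force
  have "(energy \<longlongrightarrow> energy 0) (at 0 within {0..T})"
    using continuous_on_energy T_pos by (simp add: continuous_on_def)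
  \<comment> \<open>Continuity at 0 is known only within [0, T]; for 0 < a < T/2 the point 2a lies
    in that interval.\<close>
  moreover have "filterlim (\<lambda>a. 2 * a) (at 0 within {0..T}) (at_right 0)"
    unfolding filterlim_at
    using T_pos eventually_at_right_real[of 0 "T / 2"]
    by (auto intro!: tendsto_eq_intros elim!: eventually_mono)
  ultimately have E: "((\<lambda>a. energy (2 * a)) \<longlongrightarrow> energy 0) (at_right 0)"
    by (rule filterlim_compose)
  have "((\<lambda>a. (2 * a) powr (1 - \<alpha>)) \<longlongrightarrow> 0 powr (1 - \<alpha>)) (at_right 0)"
    using \<alpha> by (intro tendsto_powr') (auto intro!: tendsto_eq_intros eventually_at_rightI[of 0 1])
  then have P: "((\<lambda>a. (2 * a) powr (1 - \<alpha>)) \<longlongrightarrow> 0) (at_right 0)" by simp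
  have "((\<lambda>a. \<mu> / 2 * energy (2 * a) + B * ((2 * a) powr (1 - \<alpha>) / (1 - \<alpha>)) / (2 * \<Gamma>\<^sub>\<alpha>) + ?C + ?E + ?S) \<longlongrightarrow>
      \<mu> / 2 * energy 0 + B * (0 / (1 - \<alpha>)) / (2 * \<Gamma>\<^sub>\<alpha>) + ?C + ?E + ?S) (at_right 0)"
    using \<alpha> less_imp_neq[OF Gamma_pos]
    by (intro tendsto_add tendsto_mult tendsto_divide tendsto_const P E) auto
  then have "((\<lambda>a. \<mu> / 2 * energy (2 * a) + B * ((2 * a) powr (1 - \<alpha>) / (1 - \<alpha>)) / (2 * \<Gamma>\<^sub>\<alpha>) + ?C + ?E + ?S) \<longlongrightarrow>
      \<mu> / 2 * energy 0 + ?C + ?E + ?S) (at_right 0)"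
    by simp
  moreover have "eventually (\<lambda>a. ?L \<le> \<mu> / 2 * energy (2 * a) + B * ((2 * a) powr (1 - \<alpha>) / (1 - \<alpha>)) / (2 * \<Gamma>\<^sub>\<alpha>) + ?C + ?E + ?S) (at_right 0)"
  proof (rule eventually_at_rightI[of 0 "t / 2"])
    fix a assume "a \<in> {0<..<t / 2}"
    then show "?L \<le> \<mu> / 2 * energy (2 * a) + B * ((2 * a) powr (1 - \<alpha>) / (1 - \<alpha>)) / (2 * \<Gamma>\<^sub>\<alpha>) + ?C + ?E + ?S"
      using t0 by (intro energy_inequality_pos B) auto
  qed (use t0 in simp)
  ultimately show ?thesis
    by (rule tendsto_lowerbound) simp
qed

section \<open>From the integrated energy inequality to the a priori estimate\<close>

lemma RL_integral_mass_nonneg: "0 \<le> RL_integral \<alpha> mass t"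
proof -
  have "0 \<le> integral {0..t} (\<lambda>\<eta>. (t - \<eta>) powr (- \<alpha>) * mass \<eta>)"
    by (cases "(\<lambda>\<eta>. (t - \<eta>) powr (- \<alpha>) * mass \<eta>) integrable_on {0..t}")
      (auto intro!: Henstock_Kurzweil_Integration.integral_nonneg mult_nonneg_nonneg mass_nonneg
        simp: not_integrable_integral)
  then show ?thesis
    unfolding RL_integral_def using Gamma_pos by (intro mult_nonneg_nonneg) auto
qed

text \<open>Dropping the nonnegative Riemann--Liouville term leaves an integral inequality for the
  energy alone, to which Gronwall applies. The resulting bound A X controls both terms: the
  fractional integral is at most 2 A X and the energy at most 2 A X / \<mu>, whence the factor 2 (1
  + 1/\<mu>).\<close>

lemma a_priori_estimate:
  assumes t: "t \<in> {0..T}"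
  shows "RL_integral \<alpha> mass t + energy t \<le>
    2 * (1 + 1 / \<mu>) * exp (2 * rate / \<mu> * T) *
      (\<mu> / 2 + T powr (1 - \<alpha>) / (1 - \<alpha>) / (2 * \<Gamma>\<^sub>\<alpha>) + 1 / 2) *
    (integral {0..t} source_mass + energy 0 + mass 0)"
proof -
  define \<kappa> where "\<kappa> = T powr (1 - \<alpha>) / (1 - \<alpha>) / (2 * \<Gamma>\<^sub>\<alpha>)"
  let ?R = "RL_integral \<alpha> mass"
  define S where "S = integral {0..t} source_mass"
  define A where "A = \<mu> / 2 * energy 0 + mass 0 * \<kappa> + S / 2"
  define X where "X = exp (2 * rate / \<mu> * T)"
  have \<kappa>: "0 \<le> \<kappa>"
    unfolding \<kappa>_def using \<alpha> less_imp_le[OF Gamma_pos] by (intro divide_nonneg_nonneg) auto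
  have ineq: "?R s / 2 + \<mu> / 2 * energy s \<le> \<mu> / 2 * energy 0 + mass 0 * \<kappa>
      + rate * integral {0..s} energy + integral {0..s} source_mass / 2" if "s \<in> {0..T}" for s
    using energy_inequality[OF that] by (simp add: \<kappa>_def)
  have S: "0 \<le> S" unfolding S_def
    by (intro Henstock_Kurzweil_Integration.integral_nonneg source_mass_integrable t source_mass_nonneg)
  have A: "0 \<le> A"
    unfolding A_def using \<mu> \<kappa> S energy_nonneg[of 0] mass_nonneg[of 0]
    by (intro add_nonneg_nonneg mult_nonneg_nonneg) auto
  have "\<mu> / 2 * energy s \<le> A + rate * integral {0..s} energy" if s: "s \<in> {0..t}" for s
  proof -
    have s': "s \<in> {0..T}" using s t by auto
    \<comment> \<open>Enlarging the domain to [0, t] makes the inhomogeneity \<open>A\<close>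
      independent of s, as \<open>gronwall_integral\<close> demands.\<close>
    have "integral {0..s} source_mass \<le> S"
      unfolding S_def using s t
      by (intro integral_subset_le source_mass_integrable) (auto simp: source_mass_nonneg)
    then show ?thesis
      using ineq[OF s'] RL_integral_mass_nonneg[of s] unfolding A_def by linarith
  qed
  then have "A + rate * integral {0..t} energy \<le> A * exp (rate / (\<mu> / 2) * t)"
    using t \<mu> rate_pos by (intro gronwall_integral continuous_on_subset[OF continuous_on_energy]) auto
  also have "\<dots> \<le> A * X"
    unfolding X_def using A \<mu> rate_pos t by (intro mult_left_mono) (auto intro!: divide_right_mono mult_left_mono)
  finally have "?R t / 2 + \<mu> / 2 * energy t \<le> A * X"
    using ineq[OF t] unfolding A_def S_def by linarith
  moreover have "0 \<le> \<mu> / 2 * energy t" "0 \<le> ?R t"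
    using \<mu> energy_nonneg[of t] RL_integral_mass_nonneg[of t] by auto
  moreover have "energy t * \<mu> = 2 * (\<mu> / 2 * energy t)" by simp
  ultimately have 1: "?R t \<le> 2 * (A * X)" and "energy t * \<mu> \<le> 2 * (A * X)" by linarith+
  then have 2: "energy t \<le> 2 * (A * X) / \<mu>" using \<mu> by (simp add: pos_le_divide_eq)
  \<comment> \<open>The sum of the three coefficients \<mu>/2, \<kappa> and 1/2 of \<open>A\<close>
    dominates each of them.\<close>
  have "A \<le> (\<mu> / 2 + \<kappa> + 1 / 2) * (S + energy 0 + mass 0)"
  proof -
    have "0 \<le> (\<mu> / 2 + \<kappa>) * S + (\<kappa> + 1 / 2) * energy 0 + (\<mu> / 2 + 1 / 2) * mass 0"
      using \<mu> \<kappa> S energy_nonneg[of 0] mass_nonneg[of 0] by (intro add_nonneg_nonneg mult_nonneg_nonneg) auto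
    moreover have "(\<mu> / 2 + \<kappa> + 1 / 2) * (S + energy 0 + mass 0) =
        A + ((\<mu> / 2 + \<kappa>) * S + (\<kappa> + 1 / 2) * energy 0 + (\<mu> / 2 + 1 / 2) * mass 0)"
      unfolding A_def by (simp add: algebra_simps)
    ultimately show ?thesis by linarith
  qed
  then have "2 * (1 + 1 / \<mu>) * X * A \<le> 2 * (1 + 1 / \<mu>) * X * ((\<mu> / 2 + \<kappa> + 1 / 2) * (S + energy 0 + mass 0))"
    using \<mu> by (intro mult_left_mono) (auto simp: X_def)
  moreover have "2 * (1 + 1 / \<mu>) * X * A = 2 * (A * X) + 2 * (A * X) / \<mu>"
    by (simp add: algebra_simps)
  ultimately show ?thesis
    using 1 2 unfolding X_def[symmetric] S_def[symmetric] \<kappa>_def[symmetric] by (simp add: mult.assoc)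
qed

end

theorem theorem1:
  fixes \<alpha> \<mu> l T c1 :: real and m :: nat and xs :: "nat \<Rightarrow> real"
  assumes "0 < \<alpha>" "\<alpha> < 1" "0 < \<mu>" "0 < T"
    and "1 \<le> m" "0 < xs 1" "strict_mono_on {1..m} xs" "xs m < l"
  shows "\<exists>M>0. \<forall>q f u0 u.
    (\<forall>k\<in>{1..m}. \<forall>x\<in>{0<..<l}. \<forall>t\<in>{0<..T}. \<bar>q k x t\<bar> < c1) \<longrightarrow>
    square_integrable_on_rectangle l T f \<longrightarrow>
    is_solution \<alpha> \<mu> l T m xs q f u0 u \<longrightarrow>
    (\<forall>t\<in>{0..T}.
       RL_integral \<alpha> (\<lambda>\<eta>. norm0_sq l (\<lambda>x. u x \<eta>)) t + norm0_sq l (\<lambda>x. partial_x l u x t)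
       \<le> M * (integral {0..t} (\<lambda>\<tau>. norm0_sq l (\<lambda>x. f x \<tau>))
              + norm0_sq l (\<lambda>x. vector_derivative u0 (at x within {0..l}))
              + norm0_sq l u0))"
proof -
  have mono: "mono_on {1..m} xs"
    using assms(7) by (rule strict_mono_on_imp_mono_on)
  have xs: "xs k \<in> {0..l}" if "k \<in> {1..m}" for k
    using mono_onD[OF mono, of 1 k] mono_onD[OF mono, of k m] that assms by force
  have l: "0 < l"
    using mono_onD[OF mono, of 1 m] assms by force
  \<comment> \<open>The constant of \<open>a_priori_estimate\<close> with \<open>rate\<close>
    written out: it is fixed before q, f, u0 and u are introduced, hence outside the locale.\<close>
  define M where "M = 2 * (1 + 1 / \<mu>) * exp (2 * (l * (real m * \<bar>c1\<bar> * l + l / 2)) / \<mu> * T) *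
      (\<mu> / 2 + T powr (1 - \<alpha>) / (1 - \<alpha>) / (2 * Gamma (1 - \<alpha>)) + 1 / 2)"
  have "0 \<le> T powr (1 - \<alpha>) / (1 - \<alpha>) / (2 * Gamma (1 - \<alpha>))"
    using assms less_imp_le[OF Gamma_real_pos[of "1 - \<alpha>"]] by (intro divide_nonneg_nonneg) auto
  then have "0 < M"
    unfolding M_def using assms(3) by (intro mult_pos_pos add_pos_nonneg add_nonneg_pos) auto
  moreover have "RL_integral \<alpha> (\<lambda>\<eta>. norm0_sq l (\<lambda>x. u x \<eta>)) t + norm0_sq l (\<lambda>x. partial_x l u x t)
       \<le> M * (integral {0..t} (\<lambda>\<tau>. norm0_sq l (\<lambda>x. f x \<tau>))
              + norm0_sq l (\<lambda>x. vector_derivative u0 (at x within {0..l}))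
              + norm0_sq l u0)"
    if q: "\<forall>k\<in>{1..m}. \<forall>x\<in>{0<..<l}. \<forall>t\<in>{0<..T}. \<bar>q k x t\<bar> < c1"
      and f: "square_integrable_on_rectangle l T f"
      and sol: "is_solution \<alpha> \<mu> l T m xs q f u0 u" and t: "t \<in> {0..T}"
    for q f u0 u t
  proof -
    interpret fractional_solution l T u \<alpha> \<mu> c1 m xs q f
      by unfold_locales (use assms l xs q f sol in \<open>auto simp: is_solution_def\<close>)
    have init: "u0 x = u x 0" if "x \<in> {0..l}" for x
      using sol that by (simp add: is_solution_def)
    \<comment> \<open>\<open>u0\<close> agrees with u(., 0) only on [0, l]; the derivative within
      that interval sees no other values and is unique because l > 0.\<close>
    have "vector_derivative u0 (at x within {0..l}) = ux x 0" if x: "x \<in> {0..l}" for x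
    proof -
      have "((\<lambda>y. u y 0) has_vector_derivative ux x 0) (at x within {0..l})"
        using deriv_ux[OF x, of 0] T_pos by (simp add: has_real_derivative_iff_has_vector_derivative)
      then have "(u0 has_vector_derivative ux x 0) (at x within {0..l})"
        by (rule has_vector_derivative_transform[OF x init, rotated])
      then show ?thesis
        using l_pos x by (intro vector_derivative_within_cbox[of 0 l, unfolded cbox_interval]) auto
    qed
    then have "norm0_sq l (\<lambda>x. vector_derivative u0 (at x within {0..l})) = energy 0"
      unfolding norm0_sq_def energy_def by (intro integral_cong) simp
    moreover have "norm0_sq l u0 = mass 0"
      unfolding norm0_sq_def mass_def by (intro integral_cong) (simp add: init)
    ultimately show ?thesis
      using a_priori_estimate[OF t]
      by (simp add: M_def rate_def mass_def[abs_def] energy_def source_mass_def[abs_def])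
  qed
  ultimately show ?thesis by blast
qed

end
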